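(* Let $\mathbb{P}$ be the Hawaiian Pants. Then: (a) $\mathbb{P}\setminus\{b_0\}$ is a 2-manifold with boundary $C_1\setminus\{b_0\}$. (b) $\mathbb{P}$ is connected and locally path connected.
   Context: The Hawaiian Pants $\mathbb{P}$: For $n\in\mathbb{N}=\{1,2,\dots\}$ let $C_n\subseteq \mathbb{R}^2$ be the circle of radius $\frac{1}{n}$ centered at $(\frac{1}{n},0)$, and let $\mathbb{H}=\bigcup_{i=1}^\infty C_i\subseteq\mathbb{R}^2$ (subspace topology) be the Hawaiian Earring, with basepoint $b_0=(0,0)$. Define $\ell_n:[0,1]\rightarrow C_n$ by $\ell_n(t)=(\frac{1}{n}(1-\cos 2\pi t),\frac{1}{n}\sin 2\pi t)$. For each $n$, let $D_{n,1},D_{n,2}$ be disjoint closed disks in the interior $D_n^\circ$ of a closed disk $D_n\subseteq\mathbb{R}^2$ and let $P_n=D_n\setminus(D_{n,1}^\circ\cup D_{n,2}^\circ)$ (a "pair of pants"). Let $\alpha_n,\beta_n,\gamma_n:[0,1]\rightarrow P_n$ be parametrizations (as simple closed curves) of the boundaries $\partial D_n,\partial D_{n,1},\partial D_{n,2}$, respectively, with clockwise orientation. Let $f_n:\partial P_n\rightarrow\mathbb{H}$ be the map with $f_n\circ\alpha_n=\ell_n$, $f_n\circ\beta_n=\ell_{2n}$, $f_n\circ\gamma_n=\ell_{2n+1}$, and let $f:\coprod_n\partial P_n\rightarrow\mathbb{H}$ be given by $f|_{\partial P_n}=f_n$. Then $\mathbb{P}=\mathbb{H}\cup_f\left(\coprod_{n\in\mathbb{N}}P_n\right)$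 is the adjunction space (quotient topology); $\mathbb{H}$ (and hence each $C_n$) is regarded as a subspace of $\mathbb{P}$. *)

theory Defs
  imports "HOL-Complex_Analysis.Complex_Analysis"
begin

section \<open>Disjoint unions, quotients and adjunction spaces\<close>

definition disjoint_union_topology :: "'a topology \<Rightarrow> 'b topology \<Rightarrow> ('a + 'b) topology" where
  "disjoint_union_topology Y X =
     topology (\<lambda>U. U \<subseteq> topspace Y <+> topspace X \<and> openin Y (Inl -` U) \<and> openin X (Inr -` U))"

lemma openin_disjoint_union_topology:
  "openin (disjoint_union_topology Y X) U \<longleftrightarrow>
     U \<subseteq> topspace Y <+> topspace X \<and> openin Y (Inl -` U) \<and> openin X (Inr -` U)"
proof -
  have "istopology (\<lambda>U. U \<subseteq> topspace Y <+> topspace X \<and>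
          openin Y (Inl -` U) \<and> openin X (Inr -` U))"
    unfolding istopology_def by (auto simp: vimage_Union)
  then show ?thesis
    by (simp add: disjoint_union_topology_def)
qed

definition quotient_topology :: "'a topology \<Rightarrow> 'a rel \<Rightarrow> 'a set topology" where
  "quotient_topology X r =
     topology (\<lambda>U. U \<subseteq> topspace X // r \<and> openin X {x \<in> topspace X. r `` {x} \<in> U})"

lemma openin_quotient_topology:
  "openin (quotient_topology X r) U \<longleftrightarrow>
     U \<subseteq> topspace X // r \<and> openin X {x \<in> topspace X. r `` {x} \<in> U}"
proof -
  have 1: "{x \<in> topspace X. r `` {x} \<in> S \<inter> T} =
      {x \<in> topspace X. r `` {x} \<in> S} \<inter> {x \<in> topspace X. r `` {x} \<in> T}" for S T
    by auto
  have 2: "{x \<in> topspace X. r `` {x} \<in> \<Union>\<K>} =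
      (\<Union>K\<in>\<K>. {x \<in> topspace X. r `` {x} \<in> K})" for \<K>
    by auto
  have "istopology (\<lambda>U. U \<subseteq> topspace X // r \<and> openin X {x \<in> topspace X. r `` {x} \<in> U})"
    unfolding istopology_def 1 2 by blast
  then show ?thesis
    by (simp add: quotient_topology_def)
qed

text \<open>The adjunction space \<open>Y \<union>\<^sub>f X\<close>, where \<open>f\<close> maps \<open>A \<subseteq> topspace X\<close> into \<open>topspace Y\<close>:
  the quotient of the disjoint union by the least equivalence relation with \<open>a \<sim> f a\<close> for
  \<open>a \<in> A\<close>. Its points are equivalence classes.\<close>

definition adjunction_rel ::
    "'a topology \<Rightarrow> 'b topology \<Rightarrow> 'b set \<Rightarrow> ('b \<Rightarrow> 'a) \<Rightarrow> ('a + 'b) rel" where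
  "adjunction_rel Y X A f =
     {(u, v). u \<in> topspace Y <+> topspace X \<and> v \<in> topspace Y <+> topspace X \<and>
        equivclp (\<lambda>u v. \<exists>a\<in>A. u = Inr a \<and> v = Inl (f a)) u v}"

definition adjunction_space ::
    "'a topology \<Rightarrow> 'b topology \<Rightarrow> 'b set \<Rightarrow> ('b \<Rightarrow> 'a) \<Rightarrow> ('a + 'b) set topology" where
  "adjunction_space Y X A f =
     quotient_topology (disjoint_union_topology Y X) (adjunction_rel Y X A f)"

section \<open>Surfaces with boundary\<close>

definition half_plane :: "complex set" where
  "half_plane = {z. 0 \<le> Im z}"

text \<open>The codomain of a chart is relatively open in the half-plane; it may avoid the
  boundary line, so ordinary planar charts are included.\<close>

definition half_plane_chart ::
    "'a topology \<Rightarrow> 'a set \<Rightarrow> ('a \<Rightarrow> complex) \<Rightarrow> bool" where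
  "half_plane_chart X U \<phi> \<longleftrightarrow>
     openin X U \<and>
     (\<exists>V. openin (top_of_set half_plane) V \<and>
          homeomorphic_map (subtopology X U) (top_of_set V) \<phi>)"

definition two_manifold_with_boundary :: "'a topology \<Rightarrow> bool" where
  "two_manifold_with_boundary X \<longleftrightarrow>
     Hausdorff_space X \<and> second_countable X \<and>
     (\<forall>p \<in> topspace X. \<exists>U \<phi>. p \<in> U \<and> half_plane_chart X U \<phi>)"

definition two_manifold_boundary :: "'a topology \<Rightarrow> 'a set" where
  "two_manifold_boundary X =
     {p \<in> topspace X. \<exists>U \<phi>. p \<in> U \<and> half_plane_chart X U \<phi> \<and> Im (\<phi> p) = 0}"

section \<open>The Hawaiian earring\<close>

text \<open>The plane is modelled by the complex numbers, and the positive integers by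
  \<open>{1..} :: nat set\<close>.\<close>

definition earring_circle :: "nat \<Rightarrow> complex set" where
  "earring_circle n = sphere (Complex (1 / n) 0) (1 / n)"

definition hawaiian_earring :: "complex set" where
  "hawaiian_earring = (\<Union>n\<in>{1..}. earring_circle n)"

definition earring_loop :: "nat \<Rightarrow> real \<Rightarrow> complex" where
  "earring_loop n t = Complex (1 / n * (1 - cos (2 * pi * t))) (1 / n * sin (2 * pi * t))"

section \<open>The Hawaiian pants\<close>

definition closed_disk :: "complex set \<Rightarrow> bool" where
  "closed_disk S \<longleftrightarrow> (\<exists>c r. 0 < r \<and> S = cball c r)"

text \<open>Clockwise means winding number \<open>-1\<close> around the enclosed points.\<close>

definition clockwise_boundary_curve :: "(real \<Rightarrow> complex) \<Rightarrow> complex set \<Rightarrow> bool" where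
  "clockwise_boundary_curve g S \<longleftrightarrow>
     simple_path g \<and> pathfinish g = pathstart g \<and> path_image g = frontier S \<and>
     (\<forall>z \<in> interior S. winding_number g z = -1)"

definition pair_of_pants :: "complex set \<Rightarrow> complex set \<Rightarrow> complex set \<Rightarrow> complex set" where
  "pair_of_pants D E F = D - (interior E \<union> interior F)"

text \<open>In the locale, \<open>D n\<close> is the outer disk and \<open>E n\<close>, \<open>F n\<close> are the two removed disks.
  The last three assumptions determine \<open>f n\<close> on the boundary of the \<open>n\<close>th pair of pants;
  its values elsewhere play no role.\<close>

locale hawaiian_pants_data =
  fixes D E F :: "nat \<Rightarrow> complex set"
    and \<alpha> \<beta> \<gamma> :: "nat \<Rightarrow> real \<Rightarrow> complex"
    and f :: "nat \<Rightarrow> complex \<Rightarrow> complex"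
  assumes disks: "\<And>n. 1 \<le> n \<Longrightarrow> closed_disk (D n) \<and> closed_disk (E n) \<and> closed_disk (F n)"
    and inside: "\<And>n. 1 \<le> n \<Longrightarrow> E n \<subseteq> interior (D n) \<and> F n \<subseteq> interior (D n)"
    and disjoint: "\<And>n. 1 \<le> n \<Longrightarrow> E n \<inter> F n = {}"
    and curve_\<alpha>: "\<And>n. 1 \<le> n \<Longrightarrow> clockwise_boundary_curve (\<alpha> n) (D n)"
    and curve_\<beta>: "\<And>n. 1 \<le> n \<Longrightarrow> clockwise_boundary_curve (\<beta> n) (E n)"
    and curve_\<gamma>: "\<And>n. 1 \<le> n \<Longrightarrow> clockwise_boundary_curve (\<gamma> n) (F n)"
    and attach_\<alpha>: "\<And>n t. 1 \<le> n \<Longrightarrow> t \<in> {0..1} \<Longrightarrow> f n (\<alpha> n t) = earring_loop n t"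
    and attach_\<beta>: "\<And>n t. 1 \<le> n \<Longrightarrow> t \<in> {0..1} \<Longrightarrow> f n (\<beta> n t) = earring_loop (2 * n) t"
    and attach_\<gamma>: "\<And>n t. 1 \<le> n \<Longrightarrow> t \<in> {0..1} \<Longrightarrow> f n (\<gamma> n t) = earring_loop (2 * n + 1) t"

definition pants_coproduct ::
    "(nat \<Rightarrow> complex set) \<Rightarrow> (nat \<Rightarrow> complex set) \<Rightarrow> (nat \<Rightarrow> complex set) \<Rightarrow>
     (nat \<times> complex) topology" where
  "pants_coproduct D E F = sum_topology (\<lambda>n. top_of_set (pair_of_pants (D n) (E n) (F n))) {1..}"

definition pants_coproduct_boundary ::
    "(nat \<Rightarrow> complex set) \<Rightarrow> (nat \<Rightarrow> complex set) \<Rightarrow> (nat \<Rightarrow> complex set) \<Rightarrow>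
     (nat \<times> complex) set" where
  "pants_coproduct_boundary D E F =
     (SIGMA n:{1..}. frontier (D n) \<union> frontier (E n) \<union> frontier (F n))"

definition hawaiian_pants ::
    "(nat \<Rightarrow> complex set) \<Rightarrow> (nat \<Rightarrow> complex set) \<Rightarrow> (nat \<Rightarrow> complex set) \<Rightarrow>
     (nat \<Rightarrow> complex \<Rightarrow> complex) \<Rightarrow> (complex + nat \<times> complex) set topology" where
  "hawaiian_pants D E F f =
     adjunction_space (top_of_set hawaiian_earring) (pants_coproduct D E F)
       (pants_coproduct_boundary D E F) (\<lambda>(n, x). f n x)"

text \<open>The canonical map of the earring into the Hawaiian pants, sending a point to its class.\<close>

definition earring_inclusion ::
    "(nat \<Rightarrow> complex set) \<Rightarrow> (nat \<Rightarrow> complex set) \<Rightarrow> (nat \<Rightarrow> complex set) \<Rightarrow>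
     (nat \<Rightarrow> complex \<Rightarrow> complex) \<Rightarrow> complex \<Rightarrow> (complex + nat \<times> complex) set" where
  "earring_inclusion D E F f y =
     adjunction_rel (top_of_set hawaiian_earring) (pants_coproduct D E F)
       (pants_coproduct_boundary D E F) (\<lambda>(n, x). f n x) `` {Inl y}"

end

theory Submission
  imports Defs
begin

text \<open>A set in the Hawaiian pants is open iff its preimages in the earring and in every pair of pants
  are, so maps and neighbourhoods can be glued piece by piece. The space is Hausdorff because
  continuous functions separate its points. Hence a continuous map from a compact planar set is a
  homeomorphism near the points where it is injective, and charts only have to be written down in
  this direction: the interior of each pair of pants is one, and for \<open>m \<ge> 2\<close> collars of the two
  boundary circles glued to \<open>C\<^sub>m\<close> form a planar strip around \<open>C\<^sub>m\<close> minus the base point. Only one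
  collar meets \<open>C\<^sub>1\<close>, which makes it the boundary; invariance of domain excludes all other points.
  The base point needs no chart: local path connectedness passes to the quotient from the earring,
  where small balls around the base point are path connected, and from the pairs of pants, each
  of which is an absolute neighbourhood retract.\<close>

section \<open>Adjunction spaces\<close>

text \<open>The index pattern is a binary tree: \<open>m\<close> is one of \<open>n\<close>,
  \<open>2 * n\<close>, \<open>2 * n + 1\<close> exactly when \<open>n\<close> is \<open>m\<close>
  or \<open>m div 2\<close>, and for \<open>m = 1\<close> the second value is 0, which indexes no
  piece. A chart near a circle would have to be defined on equivalence classes; a parametrisation by
  a compact rectangle avoids this at a price. The boundary curves are closed, so both vertical sides
  of the rectangle have the same image, and it contains the base point. Injectivity is therefore
  always claimed between a point of a smaller set without these sides and an arbitrary point of the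
  closed rectangle, which makes the smaller set saturated. This use of compactness needs the
  Hausdorff property beforehand. Neighbourhoods are awkward at the base point, where infinitely many
  circles meet; functions can be chosen on each piece separately, subject only to agreement with one
  function on the earring.\<close>

definition adjunction_class ::
    "'a topology \<Rightarrow> 'b topology \<Rightarrow> 'b set \<Rightarrow> ('b \<Rightarrow> 'a) \<Rightarrow> 'a + 'b \<Rightarrow> ('a + 'b) set" where
  "adjunction_class Y X A f u = adjunction_rel Y X A f `` {u}"

text \<open>A canonical representative: a glued point moves to its image, every other point stays.
  Values in the left summand are never moved again, so one application suffices.\<close>

definition adjunction_normal :: "'b set \<Rightarrow> ('b \<Rightarrow> 'a) \<Rightarrow> 'a + 'b \<Rightarrow> 'a + 'b" where
  "adjunction_normal A f u = (case u of Inl y \<Rightarrow> Inl y | Inr x \<Rightarrow> if x \<in> A then Inl (f x) else Inr x)"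

lemma adjunction_normal_simps [simp]:
  "adjunction_normal A f (Inl y) = Inl y"
  "x \<in> A \<Longrightarrow> adjunction_normal A f (Inr x) = Inl (f x)"
  "x \<notin> A \<Longrightarrow> adjunction_normal A f (Inr x) = Inr x"
  by (simp_all add: adjunction_normal_def)

text \<open>Each generating step preserves the normal form, and every element reaches its normal
  form in at most one step. Equality of classes thus becomes a computation without chains of
  relations.\<close>

lemma equivclp_adjunction_iff:
  "equivclp (\<lambda>u v. \<exists>a\<in>A. u = Inr a \<and> v = Inl (f a)) u v \<longleftrightarrow>
     adjunction_normal A f u = adjunction_normal A f v" (is "equivclp ?R u v \<longleftrightarrow> _")
proof
  assume "equivclp ?R u v"
  then show "adjunction_normal A f u = adjunction_normal A f v"
    by (induction rule: equivclp_induct) auto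
next
  have normal: "equivclp ?R w (adjunction_normal A f w)" for w
  proof (cases w)
    case (Inr x)
    then show ?thesis
      by (cases "x \<in> A") (auto intro!: r_into_equivclp)
  qed simp
  assume "adjunction_normal A f u = adjunction_normal A f v"
  from equivclp_trans[OF normal[of u] equivclp_sym[OF normal[of v, folded this]]]
  show "equivclp ?R u v" .
qed

lemma adjunction_rel_iff:
  "(u, v) \<in> adjunction_rel Y X A f \<longleftrightarrow>
     u \<in> topspace Y <+> topspace X \<and> v \<in> topspace Y <+> topspace X \<and>
     adjunction_normal A f u = adjunction_normal A f v"
  by (simp add: adjunction_rel_def equivclp_adjunction_iff)

lemma adjunction_class_eq_iff:
  assumes "u \<in> topspace Y <+> topspace X" "v \<in> topspace Y <+> topspace X"
  shows "adjunction_class Y X A f u = adjunction_class Y X A f v \<longleftrightarrow>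
     adjunction_normal A f u = adjunction_normal A f v"
proof
  assume "adjunction_class Y X A f u = adjunction_class Y X A f v"
  moreover have "v \<in> adjunction_class Y X A f v"
    using assms(2) unfolding adjunction_class_def adjunction_rel_iff Image_singleton_iff by simp
  ultimately have "v \<in> adjunction_class Y X A f u"
    by simp
  then show "adjunction_normal A f u = adjunction_normal A f v"
    unfolding adjunction_class_def adjunction_rel_iff Image_singleton_iff by simp
next
  assume "adjunction_normal A f u = adjunction_normal A f v"
  then show "adjunction_class Y X A f u = adjunction_class Y X A f v"
    using assms unfolding adjunction_class_def
    by (intro set_eqI) (simp only: adjunction_rel_iff Image_singleton_iff simp_thms)
qed

lemma topspace_disjoint_union_topology [simp]:
  "topspace (disjoint_union_topology Y X) = topspace Y <+> topspace X"
proof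
  have "openin (disjoint_union_topology Y X) (topspace Y <+> topspace X)"
  proof -
    have "Inl -` (topspace Y <+> topspace X) = topspace Y" "Inr -` (topspace Y <+> topspace X) = topspace X"
      by auto
    then show ?thesis
      by (simp add: openin_disjoint_union_topology)
  qed
  then show "topspace Y <+> topspace X \<subseteq> topspace (disjoint_union_topology Y X)"
    by (rule openin_subset)
qed (use openin_topspace[of "disjoint_union_topology Y X", unfolded openin_disjoint_union_topology]
     in blast)

lemma openin_adjunction_space:
  "openin (adjunction_space Y X A f) U \<longleftrightarrow>
     U \<subseteq> adjunction_class Y X A f ` (topspace Y <+> topspace X) \<and>
     openin Y {y \<in> topspace Y. adjunction_class Y X A f (Inl y) \<in> U} \<and>
     openin X {x \<in> topspace X. adjunction_class Y X A f (Inr x) \<in> U}"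
proof -
  have "(topspace Y <+> topspace X) // adjunction_rel Y X A f =
      adjunction_class Y X A f ` (topspace Y <+> topspace X)"
    by (auto simp: quotient_def adjunction_class_def)
  moreover have "Inl -` {u \<in> topspace Y <+> topspace X. adjunction_rel Y X A f `` {u} \<in> U} =
      {y \<in> topspace Y. adjunction_class Y X A f (Inl y) \<in> U}"
    "Inr -` {u \<in> topspace Y <+> topspace X. adjunction_rel Y X A f `` {u} \<in> U} =
      {x \<in> topspace X. adjunction_class Y X A f (Inr x) \<in> U}"
    by (auto simp: adjunction_class_def)
  ultimately show ?thesis
    unfolding adjunction_space_def openin_quotient_topology openin_disjoint_union_topology
    by auto
qed

section \<open>General topology\<close>

lemma second_countable_open_cover:
  assumes "countable I" and op: "\<And>i. i \<in> I \<Longrightarrow> openin X (U i)"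
    and sc: "\<And>i. i \<in> I \<Longrightarrow> second_countable (subtopology X (U i))"
    and cover: "topspace X \<subseteq> (\<Union>i\<in>I. U i)"
  shows "second_countable X"
proof -
  have "\<forall>i\<in>I. \<exists>\<B>. countable \<B> \<and> (\<forall>V \<in> \<B>. openin (subtopology X (U i)) V) \<and>
      (\<forall>W x. openin (subtopology X (U i)) W \<and> x \<in> W \<longrightarrow> (\<exists>V \<in> \<B>. x \<in> V \<and> V \<subseteq> W))"
    using sc unfolding second_countable_def by blast
  then obtain \<B> where \<B>: "\<And>i. i \<in> I \<Longrightarrow> countable (\<B> i)"
      "\<And>i V. i \<in> I \<Longrightarrow> V \<in> \<B> i \<Longrightarrow> openin (subtopology X (U i)) V"
      "\<And>i W x. i \<in> I \<Longrightarrow> openin (subtopology X (U i)) W \<Longrightarrow> x \<in> W \<Longrightarrow> \<exists>V \<in> \<B> i. x \<in> V \<and> V \<subseteq> W"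
    by metis
  show ?thesis
    unfolding second_countable_def
  proof (intro exI conjI ballI allI impI)
    show "countable (\<Union>i\<in>I. \<B> i)"
      using assms(1) \<B>(1) by blast
    show "openin X V" if "V \<in> (\<Union>i\<in>I. \<B> i)" for V
      using that \<B>(2) op openin_trans_full by blast
    show "\<exists>V\<in>\<Union>i\<in>I. \<B> i. x \<in> V \<and> V \<subseteq> W" if W: "openin X W \<and> x \<in> W" for W x
    proof -
      obtain i where i: "i \<in> I" "x \<in> U i"
        using W cover openin_subset by blast
      then have "openin (subtopology X (U i)) (U i \<inter> W)"
        using W by (simp add: openin_subtopology_Int2)
      with i \<B>(3)[of i "U i \<inter> W" x] W show ?thesis
        by blast
    qed
  qed
qed

lemma second_countable_euclidean: "second_countable (euclidean :: 'a::second_countable_topology topology)"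
proof -
  obtain B :: "'a set set" where "countable B" "topological_basis B"
    using ex_countable_basis by blast
  then show ?thesis
    unfolding second_countable_def
  proof (intro exI[of _ B] conjI ballI allI impI)
    show "openin euclidean V" if "V \<in> B" for V
      using that \<open>topological_basis B\<close> topological_basis_open by (simp flip: open_openin) blast
    show "\<exists>V\<in>B. x \<in> V \<and> V \<subseteq> U" if "openin euclidean U \<and> x \<in> U" for U x
      using that \<open>topological_basis B\<close> by (metis open_openin topological_basisE)
  qed
qed

text \<open>A continuous map from a compact space to a Hausdorff space is closed, and it stays
  closed over a saturated set. Comparing points of \<open>V\<close> with all of \<open>K\<close> in
  \<open>inj\<close> makes \<open>V\<close> the full preimage of its image; injectivity on
  \<open>V\<close> alone would not give this.\<close>

lemma homeomorphic_map_compact_restriction: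
  assumes "Hausdorff_space P" "compact K" "continuous_map (top_of_set K) P \<psi>" "V \<subseteq> K"
    and inj: "\<And>w w'. w \<in> V \<Longrightarrow> w' \<in> K \<Longrightarrow> \<psi> w = \<psi> w' \<Longrightarrow> w = w'"
  shows "homeomorphic_map (top_of_set V) (subtopology P (\<psi> ` V)) \<psi>"
proof (rule bijective_closed_imp_homeomorphic_map)
  have V: "top_of_set V = subtopology (top_of_set K) V"
    using assms(4) by (simp add: subtopology_subtopology Int_absorb1)
  have P: "\<psi> ` K \<subseteq> topspace P"
    using assms(3) by (metis continuous_map_image_subset_topspace topspace_euclidean_subtopology)
  show "continuous_map (top_of_set V) (subtopology P (\<psi> ` V)) \<psi>"
    unfolding V using assms(3)
    by (auto simp: continuous_map_in_subtopology continuous_map_from_subtopology)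
  have "closed_map (top_of_set K) P \<psi>"
    using assms(1-3) by (intro continuous_imp_closed_map) (auto simp: compact_space_subtopology)
  then show "closed_map (top_of_set V) (subtopology P (\<psi> ` V)) \<psi>"
    unfolding V by (rule closed_map_restriction) (use assms(4) inj in \<open>auto, metis\<close>)
  show "\<psi> ` topspace (top_of_set V) = topspace (subtopology P (\<psi> ` V))"
    using P assms(4) by auto
  show "inj_on \<psi> (topspace (top_of_set V))"
    using inj assms(4) by (auto simp: inj_on_def)
qed

lemma connected_space_subset_family:
  assumes "\<And>x. x \<in> topspace X \<Longrightarrow> \<exists>S. connectedin X S \<and> a \<in> S \<and> x \<in> S"
  shows "connected_space X"
  unfolding connected_space_subconnected
proof (intro strip)
  fix x y assume "x \<in> topspace X" "y \<in> topspace X"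
  then obtain S T where "connectedin X S" "a \<in> S" "x \<in> S" "connectedin X T" "a \<in> T" "y \<in> T"
    using assms by meson
  then show "\<exists>S. connectedin X S \<and> x \<in> S \<and> y \<in> S"
    by (intro exI[of _ "S \<union> T"]) (auto intro: connectedin_Un)
qed

text \<open>Compactness makes \<open>g\<close> a quotient map onto its image: closed preimages under
  \<open>h \<circ> g\<close> are compact, and so are their images under \<open>g\<close>. This gives
  continuity of a map that is known only along a parametrisation.\<close>

lemma continuous_on_compact_image_factor:
  fixes g :: "'a::topological_space \<Rightarrow> 'b::t2_space"
  assumes "compact K" "continuous_on K g" "continuous_on K (h \<circ> g)"
  shows "continuous_on (g ` K) h"
  unfolding continuous_on_closed_invariant
proof (intro allI impI)
  fix B :: "'c set" assume "closed B"
  then have "closedin (top_of_set K) (K \<inter> (h \<circ> g) -` B)"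
    using assms(3) continuous_closedin_preimage by blast
  then have "compact (K \<inter> (h \<circ> g) -` B)"
    using assms(1) closedin_compact by blast
  then have "compact (g ` (K \<inter> (h \<circ> g) -` B))"
    by (rule compact_continuous_image[OF continuous_on_subset[OF assms(2)], rotated]) auto
  then show "\<exists>A. closed A \<and> A \<inter> g ` K = h -` B \<inter> g ` K"
    by (intro exI[of _ "g ` (K \<inter> (h \<circ> g) -` B)"]) (auto simp: compact_imp_closed)
qed

text \<open>The step that carries local path connectedness through a quotient: near a point over
  \<open>C\<close>, a path connected set inside the preimage of \<open>U\<close> has a path
  connected image in \<open>U\<close> that meets the component \<open>C\<close>, hence lies in
  it.\<close>

lemma openin_preimage_path_component:
  assumes S: "locally path_connected S" and g: "continuous_map (top_of_set S) P g"
    and "openin P U" "C \<in> path_components_of (subtopology P U)"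
  shows "openin (top_of_set S) {x \<in> S. g x \<in> C}"
proof (subst openin_subopen, intro ballI)
  fix x assume x: "x \<in> {x \<in> S. g x \<in> C}"
  have CU: "C \<subseteq> U"
    using assms(4) path_components_of_subset by fastforce
  have "openin (top_of_set S) {x \<in> topspace (top_of_set S). g x \<in> U}"
    using g assms(3) by (rule openin_continuous_map_preimage)
  then have "openin (top_of_set S) {x \<in> S. g x \<in> U}" "x \<in> {x \<in> S. g x \<in> U}"
    using x CU by auto
  then obtain N N' where N: "openin (top_of_set S) N" "path_connected N'" "x \<in> N" "N \<subseteq> N'"
      "N' \<subseteq> {x \<in> S. g x \<in> U}"
    using locallyE[OF S] by blast
  have "path_connectedin (top_of_set S) N'"
    using N by (auto simp: path_connectedin_subtopology)
  then have "path_connectedin P (g ` N')"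
    using g path_connectedin_continuous_map_image by blast
  then have "path_connectedin (subtopology P U) (g ` N')"
    using N by (auto simp: path_connectedin_subtopology)
  moreover have "g x \<in> C" "g x \<in> g ` N'"
    using x N by auto
  ultimately have "g ` N' \<subseteq> C"
    using assms(4) path_components_of_maximal by (metis disjnt_iff)
  then show "\<exists>T. openin (top_of_set S) T \<and> x \<in> T \<and> T \<subseteq> {x \<in> S. g x \<in> C}"
    using N by (intro exI[of _ N]) blast
qed

lemma separate_by_continuous_map:
  fixes g :: "'a \<Rightarrow> 'b::t2_space"
  assumes "continuous_map X euclidean g" "g x \<noteq> g y" "x \<in> topspace X" "y \<in> topspace X"
  shows "\<exists>U V. openin X U \<and> openin X V \<and> x \<in> U \<and> y \<in> V \<and> disjnt U V"
proof -
  obtain A B where AB: "open A" "open B" "g x \<in> A" "g y \<in> B" "A \<inter> B = {}"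
    using hausdorff[OF assms(2)] by blast
  have "openin X {z \<in> topspace X. g z \<in> A}" "openin X {z \<in> topspace X. g z \<in> B}"
    using AB by (auto intro!: openin_continuous_map_preimage[OF assms(1)])
  then show ?thesis
    using AB assms by (intro exI[of _ "{z \<in> topspace X. g z \<in> A}"] exI[of _ "{z \<in> topspace X. g z \<in> B}"])
      (auto simp: disjnt_def)
qed

section \<open>Charts\<close>

lemma second_countable_chart_domain:
  fixes V :: "complex set"
  assumes "homeomorphic_map (top_of_set V) (subtopology X U) \<psi>"
  shows "second_countable (subtopology X U)"
  using homeomorphic_space_second_countability[OF homeomorphic_map_imp_homeomorphic_space[OF assms]]
    second_countable_subtopology[OF second_countable_euclidean] by blast

text \<open>The value of the chart is kept in the conclusion because boundary points are recognised
  by its imaginary part.\<close>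

lemma half_plane_chart_inverse:
  assumes "openin X (\<psi> ` V)" "openin (top_of_set half_plane) V"
    and \<psi>: "homeomorphic_map (top_of_set V) (subtopology X (\<psi> ` V)) \<psi>"
  obtains \<phi> where "half_plane_chart X (\<psi> ` V) \<phi>" "\<And>w. w \<in> V \<Longrightarrow> \<phi> (\<psi> w) = w"
proof -
  obtain \<phi> where \<phi>: "homeomorphic_maps (top_of_set V) (subtopology X (\<psi> ` V)) \<psi> \<phi>"
    using \<psi> homeomorphic_map_maps by blast
  then have "homeomorphic_map (subtopology X (\<psi> ` V)) (top_of_set V) \<phi>"
    by (meson homeomorphic_maps_map)
  then have "half_plane_chart X (\<psi> ` V) \<phi>"
    using assms by (auto simp: half_plane_chart_def)
  then show thesis
    using \<phi> that by (auto simp: homeomorphic_maps_def)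
qed

lemma half_plane_chart_planar:
  fixes V :: "complex set"
  assumes "openin X (\<psi> ` V)" "open V" "bounded V"
    and \<psi>: "homeomorphic_map (top_of_set V) (subtopology X (\<psi> ` V)) \<psi>"
  shows "\<exists>\<phi>. half_plane_chart X (\<psi> ` V) \<phi>"
proof -
  obtain b where b: "\<And>z. z \<in> V \<Longrightarrow> norm z \<le> b"
    using assms(3) by (auto simp: bounded_iff)
  \<comment> \<open>Since \<open>Im z\<close> is at least \<open>- norm z\<close>, shifting upwards
    by a bound for the norm moves all of \<open>V\<close> into the half-plane.\<close>
  define a where "a = Complex 0 b"
  have "homeomorphic_map (top_of_set ((+) a ` V)) (top_of_set V) (\<lambda>z. z - a)"
    unfolding homeomorphic_map_maps homeomorphic_maps_def
    by (intro exI[of _ "\<lambda>z. z + a"]) (auto simp: continuous_map_in_subtopology intro!: continuous_intros)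
  then have "homeomorphic_map (top_of_set ((+) a ` V)) (subtopology X (\<psi> ` V)) (\<psi> \<circ> (\<lambda>z. z - a))"
    using \<psi> homeomorphic_map_compose by blast
  moreover have "(+) a ` V \<subseteq> half_plane"
  proof clarify
    fix z assume "z \<in> V"
    then show "a + z \<in> half_plane"
      using b[of z] abs_Im_le_cmod[of z] by (auto simp: half_plane_def a_def)
  qed
  then have "openin (top_of_set half_plane) ((+) a ` V)"
    using assms(2) by (simp add: open_subset open_translation)
  moreover have "(\<psi> \<circ> (\<lambda>z. z - a)) ` (+) a ` V = \<psi> ` V"
    by (force simp: image_image)
  ultimately show ?thesis
    using half_plane_chart_inverse[of X "\<psi> \<circ> (\<lambda>z. z - a)" "(+) a ` V"] assms(1) by metis
qed

text \<open>By invariance of domain, \<open>\<phi> \<circ> \<psi>\<close> has an open image in the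
  plane. An open set contained in the half-plane cannot contain a point of the boundary
  line.\<close>

lemma half_plane_chart_planar_point:
  fixes V :: "complex set"
  assumes "open V" and \<psi>: "continuous_map (top_of_set V) X \<psi>" "inj_on \<psi> V"
    and \<phi>: "half_plane_chart X U \<phi>" and "w \<in> V" "\<psi> w \<in> U"
  shows "Im (\<phi> (\<psi> w)) \<noteq> 0"
proof
  assume 0: "Im (\<phi> (\<psi> w)) = 0"
  obtain V' where U: "openin X U" and V': "openin (top_of_set half_plane) V'"
      "homeomorphic_map (subtopology X U) (top_of_set V') \<phi>"
    using \<phi> by (auto simp: half_plane_chart_def)
  define W where "W = {z \<in> V. \<psi> z \<in> U}"
  have "openin (top_of_set V) W"
    using openin_continuous_map_preimage[OF \<psi>(1) U] by (simp add: W_def)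
  then have W: "open W"
    using assms(1) openin_open_trans by blast
  have "continuous_map (top_of_set W) (subtopology X U) \<psi>"
    using \<psi>(1) continuous_map_from_subtopology_mono[of euclidean V X \<psi> W]
    by (auto simp: W_def continuous_map_in_subtopology)
  then have "continuous_map (top_of_set W) (top_of_set V') (\<phi> \<circ> \<psi>)"
    using V'(2) continuous_map_compose homeomorphic_imp_continuous_map by blast
  then have cont: "continuous_on W (\<phi> \<circ> \<psi>)" and sub: "(\<phi> \<circ> \<psi>) ` W \<subseteq> V'"
    by (auto simp: continuous_map_in_subtopology)
  have "inj_on \<phi> (topspace (subtopology X U))"
    using V'(2) homeomorphic_imp_injective_map by blast
  moreover have "\<psi> ` W \<subseteq> topspace (subtopology X U)"
    using U openin_subset by (fastforce simp: W_def)
  moreover have "inj_on \<psi> W"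
    using \<psi>(2) by (auto simp: W_def inj_on_def)
  ultimately have "inj_on (\<phi> \<circ> \<psi>) W"
    by (meson comp_inj_on inj_on_subset)
  then have "open ((\<phi> \<circ> \<psi>) ` W)"
    by (rule invariance_of_domain[OF cont W])
  moreover have "\<phi> (\<psi> w) \<in> (\<phi> \<circ> \<psi>) ` W"
    using assms by (auto simp: W_def)
  ultimately obtain e where e: "e > 0" "ball (\<phi> (\<psi> w)) e \<subseteq> (\<phi> \<circ> \<psi>) ` W"
    by (meson openE)
  \<comment> \<open>The point straight below stays in the ball, but its imaginary part is
    negative.\<close>
  have "\<phi> (\<psi> w) - Complex 0 (e / 2) \<in> ball (\<phi> (\<psi> w)) e"
    using e(1) by (simp add: dist_norm cmod_def)
  then have "\<phi> (\<psi> w) - Complex 0 (e / 2) \<in> half_plane"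
    using e(2) sub V'(1) openin_subset by fastforce
  then show False
    using 0 e(1) by (simp add: half_plane_def)
qed

section \<open>The earring\<close>

lemma continuous_on_earring_loop: "continuous_on A (earring_loop n)"
  unfolding earring_loop_def by (intro continuous_intros)

text \<open>The constant terms cancel when the squared distance to the centre is expanded. In this
  form a point other than 0 determines the index \<open>n\<close>.\<close>

lemma mem_earring_circle:
  assumes "1 \<le> n"
  shows "z \<in> earring_circle n \<longleftrightarrow> n * (norm z)\<^sup>2 = 2 * Re z"
proof -
  have "z \<in> earring_circle n \<longleftrightarrow> (dist (Complex (1 / n) 0) z)\<^sup>2 = (1 / n)\<^sup>2"
    by (simp add: earring_circle_def power2_eq_iff_nonneg)
  also have "\<dots> \<longleftrightarrow> (1 / n - Re z)\<^sup>2 + (Im z)\<^sup>2 = (1 / n)\<^sup>2"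
    by (simp add: dist_norm cmod_power2)
  also have "\<dots> \<longleftrightarrow> (1 / n) * (n * ((Re z)\<^sup>2 + (Im z)\<^sup>2)) = (1 / n) * (2 * Re z)"
    using assms by (simp add: power2_diff algebra_simps power2_eq_square)
  also have "\<dots> \<longleftrightarrow> n * ((Re z)\<^sup>2 + (Im z)\<^sup>2) = 2 * Re z"
    using assms by (subst mult_left_cancel) auto
  finally show ?thesis
    by (simp add: cmod_power2)
qed

lemma zero_in_earring_circle: "0 \<in> earring_circle n"
  by (simp add: earring_circle_def dist_norm cmod_def)

lemma earring_circle_Int:
  assumes "1 \<le> m" "1 \<le> n" "z \<in> earring_circle m" "z \<in> earring_circle n" "z \<noteq> 0"
  shows "m = n"
proof -
  have "real m * (norm z)\<^sup>2 = n * (norm z)\<^sup>2"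
    using assms by (simp add: mem_earring_circle)
  then show ?thesis
    using assms(5) by simp
qed

lemma earring_loop_image:
  assumes "1 \<le> n"
  shows "earring_loop n ` {0..1} = earring_circle n"
proof (intro equalityI subsetI)
  fix z assume "z \<in> earring_loop n ` {0..1}"
  then obtain t where z: "z = earring_loop n t"
    by blast
  have "n * (norm z)\<^sup>2 = (2 - 2 * cos (2 * pi * t) + ((cos (2 * pi * t))\<^sup>2 + (sin (2 * pi * t))\<^sup>2) - 1) / n"
    using assms by (simp only: z earring_loop_def cmod_power2 complex.sel) (simp add: field_simps power2_eq_square)
  also have "\<dots> = 2 * Re z"
    using assms by (simp add: z earring_loop_def field_simps)
  finally show "z \<in> earring_circle n"
    using assms by (simp add: mem_earring_circle)
next
  fix z assume "z \<in> earring_circle n"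
  then have z: "n * ((Re z)\<^sup>2 + (Im z)\<^sup>2) = 2 * Re z"
    using assms by (simp add: mem_earring_circle cmod_power2)
  \<comment> \<open>Scaling by \<open>n\<close> gives the unit circle around 1, on which the angle
    can be read off.\<close>
  have "n * (n * ((Re z)\<^sup>2 + (Im z)\<^sup>2)) = n * (2 * Re z)"
    by (simp only: z)
  then have "(1 - n * Re z)\<^sup>2 + (n * Im z)\<^sup>2 = 1"
    by (simp add: power2_eq_square algebra_simps)
  then obtain s where s: "0 \<le> s" "s < 2 * pi" "1 - n * Re z = cos s" "n * Im z = sin s"
    by (metis sincos_total_2pi)
  have "z = earring_loop n (s / (2 * pi))"
    using assms s by (simp add: complex_eq_iff earring_loop_def field_simps)
  moreover have "s / (2 * pi) \<in> {0..1}"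
    using s by (simp add: field_simps)
  ultimately show "z \<in> earring_loop n ` {0..1}"
    by blast
qed

lemma earring_loop_in_earring: "1 \<le> m \<Longrightarrow> t \<in> {0..1} \<Longrightarrow> earring_loop m t \<in> hawaiian_earring"
  using earring_loop_image by (force simp: hawaiian_earring_def)

text \<open>The parameters differ by an integer. As \<open>t\<close> is not an end point, their
  distance is less than 1, so the integer is 0; at the end points the claim fails because both are
  sent to 0.\<close>

lemma earring_loop_inject:
  assumes "1 \<le> n" "t \<in> {0<..<1}" "t' \<in> {0..1}" "earring_loop n t = earring_loop n t'"
  shows "t = t'"
proof -
  have "sin (2 * pi * t) = sin (2 * pi * t') \<and> cos (2 * pi * t) = cos (2 * pi * t')"
    using assms by (simp add: earring_loop_def)
  then obtain k :: int where "2 * pi * t = 2 * pi * t' + 2 * pi * k"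
    unfolding sin_cos_eq_iff by auto
  then have "2 * pi * t = 2 * pi * (t' + k)"
    by (simp add: algebra_simps)
  then have "t = t' + k"
    by simp
  moreover have "\<bar>t - t'\<bar> < 1"
    using assms by auto
  ultimately show ?thesis
    by simp
qed

lemma earring_loop_eq_0_iff:
  assumes "1 \<le> n" "t \<in> {0..1}"
  shows "earring_loop n t = 0 \<longleftrightarrow> t = 0 \<or> t = 1"
proof -
  have ends: "earring_loop n 0 = 0" "earring_loop n 1 = 0"
    by (simp_all add: earring_loop_def complex_eq_iff)
  moreover have False if "earring_loop n t = 0" "t \<noteq> 0" "t \<noteq> 1"
    using earring_loop_inject[of n t 0] ends assms that by auto
  ultimately show ?thesis
    by auto
qed

lemma earring_circle_minus_0:
  assumes "1 \<le> n"
  shows "earring_circle n - {0} = earring_loop n ` {0<..<1}"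
proof -
  have "earring_loop n t = 0 \<longleftrightarrow> t \<notin> {0<..<1}" if "t \<in> {0..1}" for t
    using earring_loop_eq_0_iff[OF assms that] that by auto
  then have "earring_loop n ` {0..1} - {0} = earring_loop n ` ({0..1} \<inter> {0<..<1})"
    by (auto simp del: greaterThanLessThan_iff atLeastAtMost_iff)
  also have "{0..1} \<inter> {0<..<1} = {0<..<1::real}"
    by auto
  finally show ?thesis
    by (simp only: earring_loop_image[OF assms])
qed

lemma abs_less_half_nat_diff:
  fixes m n :: nat
  assumes "\<bar>real m - real n\<bar> < 1/2"
  shows "m = n"
proof -
  have "real m < real (Suc n)" "real n < real (Suc m)"
    using assms by linarith+
  then show ?thesis
    by simp
qed

text \<open>The function \<open>2 * Re z / (norm z)\<^sup>2\<close> is continuous off 0 and equals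
  \<open>n\<close> on the \<open>n\<close>th circle, so a band of radius 1/2 around \<open>m\<close>
  isolates the circle \<open>m\<close>.\<close>

lemma openin_earring_circle_minus_0:
  assumes "1 \<le> m"
  shows "openin (top_of_set hawaiian_earring) (earring_circle m - {0})"
proof -
  define h where "h z = 2 * Re z / (norm z)\<^sup>2" for z :: complex
  have h: "h z = n" if "z \<in> earring_circle n" "z \<noteq> 0" "1 \<le> n" for z n
    using that by (simp add: h_def mem_earring_circle field_simps)
  have "continuous_on (- {0}) h"
    unfolding h_def by (intro continuous_intros) auto
  then have "open (- {0} \<inter> h -` {m - 1/2<..<m + 1/2})"
    by (intro continuous_open_preimage) auto
  moreover have "earring_circle m - {0} = hawaiian_earring \<inter> (- {0} \<inter> h -` {m - 1/2<..<m + 1/2})"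
  proof -
    have "\<bar>h z - m\<bar> < 1/2 \<longleftrightarrow> z \<in> earring_circle m" if "z \<in> hawaiian_earring" "z \<noteq> 0" for z
    proof -
      obtain n where "1 \<le> n" "z \<in> earring_circle n"
        using \<open>z \<in> hawaiian_earring\<close> by (auto simp: hawaiian_earring_def)
      then show ?thesis
        using h[of z n] h[of z m] assms \<open>z \<noteq> 0\<close> abs_less_half_nat_diff[of n m] by auto
    qed
    moreover have "earring_circle m \<subseteq> hawaiian_earring"
      using assms by (auto simp: hawaiian_earring_def)
    moreover have "z \<in> h -` {m - 1/2<..<m + 1/2} \<longleftrightarrow> \<bar>h z - m\<bar> < 1/2" for z
      unfolding vimage_eq greaterThanLessThan_iff by linarith
    ultimately show ?thesis
      by blast
  qed
  ultimately show ?thesis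
    by (metis openin_open)
qed

text \<open>From \<open>z\<close>, follow the circle back to 0 along the arc that avoids the point
  opposite to 0; the norm never exceeds its initial value. This bound keeps the arc inside every
  ball around 0 that contains \<open>z\<close>.\<close>

lemma earring_path_to_0:
  assumes "z \<in> hawaiian_earring"
  obtains S where "path_connected S" "S \<subseteq> hawaiian_earring" "0 \<in> S" "z \<in> S"
    "\<And>w. w \<in> S \<Longrightarrow> norm w \<le> norm z"
proof -
  obtain n where n: "1 \<le> n" "z \<in> earring_circle n"
    using assms by (auto simp: hawaiian_earring_def)
  then obtain t where t: "t \<in> {0..1}" "z = earring_loop n t"
    by (metis earring_loop_image imageE)
  define I where "I = (if t \<le> 1/2 then {0..t} else {t..1})"
  have I: "I \<subseteq> {0..1}" "t \<in> I" "0 \<in> I \<or> 1 \<in> I"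
    using t by (auto simp: I_def)
  \<comment> \<open>By the equation of the circle the squared norm is a multiple of the real part,
    so comparing norms means comparing cosines.\<close>
  have norm: "(norm (earring_loop n s))\<^sup>2 = 2 / n * (1 / n * (1 - cos (2 * pi * s)))" if "s \<in> {0..1}" for s
  proof -
    have "earring_loop n s \<in> earring_circle n"
      using n(1) that earring_loop_image by blast
    then show ?thesis
      using n(1) by (simp add: mem_earring_circle earring_loop_def[of n s] field_simps)
  qed
  have cos: "cos (2 * pi * t) \<le> cos (2 * pi * s)" if "s \<in> I" for s
  proof (cases "t \<le> 1/2")
    case True
    then show ?thesis
      using that t by (intro cos_monotone_0_pi_le) (auto simp: I_def)
  next
    case False
    \<comment> \<open>Reflecting the parameter reduces the second half of the loop to the range
      where the cosine is monotone.\<close>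
    have "cos (2 * pi * (1 - t)) \<le> cos (2 * pi * (1 - s))"
      using False that t by (intro cos_monotone_0_pi_le) (auto simp: I_def)
    then show ?thesis
      by (simp add: right_diff_distrib cos_diff)
  qed
  show thesis
  proof
    have "path_connected I"
      by (simp add: I_def)
    then show "path_connected (earring_loop n ` I)"
      by (intro path_connected_continuous_image continuous_on_earring_loop)
    show "earring_loop n ` I \<subseteq> hawaiian_earring"
      using n(1) I(1) earring_loop_image[OF n(1)] by (force simp: hawaiian_earring_def)
    show "0 \<in> earring_loop n ` I"
      using I earring_loop_eq_0_iff[OF n(1)] by (force simp: image_iff)
    show "z \<in> earring_loop n ` I"
      using I t by blast
    show "norm w \<le> norm z" if "w \<in> earring_loop n ` I" for w
    proof -
      obtain s where s: "s \<in> I" "w = earring_loop n s"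
        using \<open>w \<in> _\<close> by blast
      then have "s \<in> {0..1}"
        using I(1) by blast
      then have "(norm w)\<^sup>2 \<le> (norm z)\<^sup>2"
        unfolding s(2) t(2) norm[OF \<open>s \<in> {0..1}\<close>] norm[OF t(1)]
        using cos[OF s(1)] by (intro mult_left_mono) auto
      then show ?thesis
        by (rule power2_le_imp_le) simp
    qed
  qed
qed

lemma zero_in_earring: "0 \<in> hawaiian_earring"
  using zero_in_earring_circle by (force simp: hawaiian_earring_def)

lemma path_connected_earring_ball:
  assumes "0 < e"
  shows "path_connected (hawaiian_earring \<inter> ball 0 e)"
proof -
  have "path_component (hawaiian_earring \<inter> ball 0 e) 0 z" if z: "z \<in> hawaiian_earring \<inter> ball 0 e" for z
  proof -
    obtain S where S: "path_connected S" "S \<subseteq> hawaiian_earring" "0 \<in> S" "z \<in> S"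
        "\<And>w. w \<in> S \<Longrightarrow> norm w \<le> norm z"
      using z earring_path_to_0 by blast
    then have "path_component S 0 z"
      by (simp add: path_connected_component)
    moreover have "S \<subseteq> hawaiian_earring \<inter> ball 0 e"
      using S z by force
    ultimately show ?thesis
      using path_component_of_subset by blast
  qed
  then show ?thesis
    unfolding path_connected_component by (meson path_component_sym path_component_trans)
qed

lemma connected_earring: "connected hawaiian_earring"
proof -
  have "connected (\<Union>n\<in>{1..}. earring_circle n)"
  proof (rule connected_Union)
    show "connected S" if "S \<in> earring_circle ` {1..}" for S
      using that by (auto simp: earring_circle_def intro!: connected_sphere)
    show "\<Inter> (earring_circle ` {1..}) \<noteq> {}"
      using zero_in_earring_circle by blast
  qed
  then show ?thesis
    by (simp add: hawaiian_earring_def)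
qed

text \<open>Off the base point the earring agrees locally with a single circle, because that circle
  without 0 is open in it; the property is then inherited from the sphere.\<close>

lemma locally_path_connected_earring: "locally path_connected hawaiian_earring"
proof (rule locallyI)
  fix w x assume w: "openin (top_of_set hawaiian_earring) w" "x \<in> w"
  then obtain T where T: "open T" "w = hawaiian_earring \<inter> T"
    by (auto simp: openin_open)
  show "\<exists>u v. openin (top_of_set hawaiian_earring) u \<and> path_connected v \<and> x \<in> u \<and> u \<subseteq> v \<and> v \<subseteq> w"
  proof (cases "x = 0")
    case True
    then obtain e where "0 < e" "ball 0 e \<subseteq> T"
      using T w openE by blast
    moreover have "openin (top_of_set hawaiian_earring) (hawaiian_earring \<inter> ball 0 e)"
      by (simp add: openin_open_Int)
    ultimately show ?thesis
      using True w T path_connected_earring_ball[of e]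
      by (intro exI[of _ "hawaiian_earring \<inter> ball 0 e"]) auto
  next
    case False
    obtain m where m: "1 \<le> m" "x \<in> earring_circle m"
      using w T by (auto simp: hawaiian_earring_def)
    have "openin (top_of_set (earring_circle m)) (earring_circle m \<inter> (T - {0}))"
      using T by (intro openin_open_Int) (simp add: open_delete)
    moreover have "x \<in> earring_circle m \<inter> (T - {0})"
      using False m w T by auto
    moreover have "locally path_connected (earring_circle m)"
      by (simp add: earring_circle_def locally_path_connected_sphere)
    ultimately obtain u v where uv: "openin (top_of_set (earring_circle m)) u" "path_connected v"
        "x \<in> u" "u \<subseteq> v" "v \<subseteq> earring_circle m \<inter> (T - {0})"
      by (meson locallyE)
    have "openin (top_of_set (earring_circle m - {0})) u"
      using uv by (intro openin_subset_trans[OF uv(1)]) auto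
    then have "openin (top_of_set hawaiian_earring) u"
      using openin_earring_circle_minus_0[OF m(1)] openin_trans by blast
    moreover have "v \<subseteq> w"
      using uv m T by (auto simp: hawaiian_earring_def)
    ultimately show ?thesis
      using uv by blast
  qed
qed

section \<open>Collars of circles\<close>

definition unit_square :: "complex set" where
  "unit_square = {w. 0 \<le> Re w \<and> Re w \<le> 1 \<and> 0 \<le> Im w \<and> Im w \<le> 1}"

text \<open>The bottom side is kept, since it will lie on the circle. The vertical sides are dropped
  because the curve closes up there, the top side because the collar ends there.\<close>

definition half_open_square :: "complex set" where
  "half_open_square = {w. 0 < Re w \<and> Re w < 1 \<and> 0 \<le> Im w \<and> Im w < 1}"

lemma half_open_square_subset: "half_open_square \<subseteq> unit_square"
  by (auto simp: half_open_square_def unit_square_def)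

text \<open>The sign \<open>s\<close> selects the side of the circle: \<open>1\<close> for a collar inside it, \<open>-1\<close> for a
  collar outside it.\<close>

lemma circle_collar:
  fixes g :: "real \<Rightarrow> complex" and s r :: real
  assumes g: "simple_path g" "pathfinish g = pathstart g" "path_image g = sphere c r"
    and "0 < r" and s: "s = 1 \<or> s = -1"
    and T: "closed T" "sphere c r \<inter> T = {}"
    and S: "S \<subseteq> {z. 0 \<le> s * (r - dist c z)}" "{z. 0 \<le> s * (r - dist c z)} - T \<subseteq> S"
  obtains \<kappa> where "continuous_on unit_square \<kappa>" "\<kappa> ` unit_square \<subseteq> S - T"
    "\<And>w. w \<in> unit_square \<Longrightarrow> Im w = 0 \<Longrightarrow> \<kappa> w = g (Re w)"
    "\<And>w. w \<in> unit_square \<Longrightarrow> 0 < Im w \<Longrightarrow> 0 < s * (r - dist c (\<kappa> w))"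
    "\<And>w w'. w \<in> half_open_square \<Longrightarrow> w' \<in> unit_square \<Longrightarrow> \<kappa> w = \<kappa> w' \<Longrightarrow> w = w'"
    "openin (top_of_set S) (\<kappa> ` half_open_square)"
proof -
  obtain d where d: "0 < d" "\<And>x y. x \<in> sphere c r \<Longrightarrow> y \<in> T \<Longrightarrow> d \<le> dist x y"
    using separate_compact_closed[OF compact_sphere T] by blast
  \<comment> \<open>A point at height \<open>Im w\<close> is pushed off the circle by
    \<open>\<epsilon> * r * Im w\<close>. So \<open>\<epsilon> * r < d\<close> keeps the collar away
    from \<open>T\<close>, and the bound 1/2 keeps the scaling factor \<open>l w\<close> positive,
    so that the centre is avoided.\<close>
  define \<epsilon> where "\<epsilon> = min (1/2) (d / (2 * r))"
  have \<epsilon>: "0 < \<epsilon>" "\<epsilon> \<le> 1/2" "\<epsilon> * r < d"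
    using d(1) \<open>0 < r\<close> by (auto simp: \<epsilon>_def min_def field_simps)
  define l where "l w = 1 - s * \<epsilon> * Im w" for w
  define \<kappa> where "\<kappa> w = c + l w *\<^sub>R (g (Re w) - c)" for w
  have l: "0 < l w" if "w \<in> unit_square" for w
  proof -
    have "\<epsilon> * Im w \<le> 1/2 * 1"
      using that \<epsilon> by (intro mult_mono) (auto simp: unit_square_def)
    moreover have "0 \<le> \<epsilon> * Im w"
      using that \<epsilon> by (auto simp: unit_square_def)
    ultimately show ?thesis
      using s by (auto simp: l_def)
  qed
  have gsphere: "dist c (g t) = r" if "t \<in> {0..1}" for t
    using g(3) that by (auto simp: path_image_def)
  have dist: "dist c (\<kappa> w) = l w * r" if "w \<in> unit_square" for w
    using l[OF that] gsphere[of "Re w"] that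
    by (simp add: \<kappa>_def dist_norm unit_square_def norm_minus_commute)
  \<comment> \<open>The signed distance to the circle recovers the height \<open>Im w\<close>;
    radial projection to the circle, in \<open>cancel\<close> below, recovers
    \<open>g (Re w)\<close>.\<close>
  have depth: "s * (r - dist c (\<kappa> w)) = \<epsilon> * r * Im w" if "w \<in> unit_square" for w
    using s dist[OF that] by (auto simp: l_def algebra_simps)
  have gfree: "t = t'" if "t \<in> {0<..<1}" "t' \<in> {0..1}" "g t = g t'" for t t'
    using g(1) that unfolding simple_path_def loop_free_def by fastforce
  have g01: "g 1 = g 0"
    using g(2) by (simp add: pathfinish_def pathstart_def)
  have notT: "\<kappa> w \<notin> T" if w: "w \<in> unit_square" for w
  proof
    assume "\<kappa> w \<in> T"
    moreover have "g (Re w) \<in> sphere c r"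
      using gsphere w by (simp add: unit_square_def)
    ultimately have "d \<le> dist (g (Re w)) (\<kappa> w)"
      using d(2) by blast
    also have "g (Re w) - \<kappa> w = (1 - l w) *\<^sub>R (g (Re w) - c)"
      by (simp add: \<kappa>_def algebra_simps)
    then have "dist (g (Re w)) (\<kappa> w) = \<bar>1 - l w\<bar> * r"
      using gsphere[of "Re w"] w by (simp add: dist_norm unit_square_def norm_minus_commute)
    also have "\<bar>1 - l w\<bar> = \<epsilon> * Im w"
      using s \<epsilon> w by (auto simp: l_def unit_square_def abs_mult)
    also have "\<epsilon> * Im w * r \<le> \<epsilon> * 1 * r"
      using \<epsilon> w \<open>0 < r\<close> by (intro mult_right_mono mult_left_mono) (auto simp: unit_square_def)
    finally show False
      using \<epsilon>(3) by simp
  qed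
  have inS: "\<kappa> w \<in> S" if w: "w \<in> unit_square" for w
  proof -
    have "0 \<le> s * (r - dist c (\<kappa> w))"
      using depth[OF w] \<epsilon> \<open>0 < r\<close> w by (simp add: unit_square_def)
    then show ?thesis
      using S(2) notT[OF w] by blast
  qed
  have cancel: "g (Re w) = c + (r / dist c (\<kappa> w)) *\<^sub>R (\<kappa> w - c)" if w: "w \<in> unit_square" for w
  proof -
    have "\<kappa> w - c = l w *\<^sub>R (g (Re w) - c)"
      by (simp add: \<kappa>_def)
    then show ?thesis
      using l[OF w] \<open>0 < r\<close> by (simp add: dist[OF w])
  qed
  \<comment> \<open>The open conditions that cut the collar out of \<open>S\<close>: the radial
    projection misses the point where the curve closes up, and the depth stays below its maximum.
    Nonnegative depth is already guaranteed by \<open>S\<close>.\<close>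
  define W where "W = (- {c} \<inter> (\<lambda>z. c + (r / dist c z) *\<^sub>R (z - c)) -` (- {g 0})) \<inter>
      {z. s * (r - dist c z) < \<epsilon> * r}"
  have "continuous_on (- {c}) (\<lambda>z. c + (r / dist c z) *\<^sub>R (z - c))"
    by (intro continuous_intros) auto
  then have "open (- {c} \<inter> (\<lambda>z. c + (r / dist c z) *\<^sub>R (z - c)) -` (- {g 0}))"
    by (rule continuous_open_preimage) auto
  moreover have "open {z. s * (r - dist c z) < \<epsilon> * r}"
    by (intro open_Collect_less continuous_intros)
  ultimately have W: "open W"
    by (simp add: W_def open_Int)
  have "\<kappa> ` half_open_square = S \<inter> W"
  proof (intro equalityI subsetI)
    fix z assume "z \<in> \<kappa> ` half_open_square"
    then obtain w where w: "w \<in> half_open_square" "z = \<kappa> w"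
      by blast
    then have w': "w \<in> unit_square"
      using half_open_square_subset by blast
    have "g (Re w) \<noteq> g 0"
      using gfree[of "Re w" 0] w by (auto simp: half_open_square_def)
    moreover have "\<epsilon> * r * Im w < \<epsilon> * r * 1"
      using \<epsilon> \<open>0 < r\<close> w by (intro mult_strict_left_mono) (auto simp: half_open_square_def)
    moreover have "0 < dist c (\<kappa> w)"
      using l[OF w'] \<open>0 < r\<close> by (simp add: dist[OF w'])
    ultimately show "z \<in> S \<inter> W"
      using inS[OF w'] cancel[OF w'] depth[OF w'] by (auto simp: W_def w(2))
  next
    fix z assume z: "z \<in> S \<inter> W"
    then have zc: "z \<noteq> c"
      by (auto simp: W_def)
    then have "c + (r / dist c z) *\<^sub>R (z - c) \<in> sphere c r"
      using \<open>0 < r\<close> by (simp add: dist_norm norm_minus_commute)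
    then obtain t where t: "t \<in> {0..1}" "g t = c + (r / dist c z) *\<^sub>R (z - c)"
      using g(3) by (metis imageE path_image_def)
    have "t \<noteq> 0" "t \<noteq> 1"
      using z t g01 by (auto simp: W_def)
    define w where "w = Complex t (s * (r - dist c z) / (\<epsilon> * r))"
    have "w \<in> half_open_square"
      using z t \<open>t \<noteq> 0\<close> \<open>t \<noteq> 1\<close> S(1) \<epsilon> \<open>0 < r\<close>
      by (auto simp: half_open_square_def w_def W_def divide_simps)
    moreover have "l w = dist c z / r"
      using s \<epsilon> \<open>0 < r\<close> by (auto simp: l_def w_def field_simps)
    then have "\<kappa> w = z"
      using zc \<open>0 < r\<close> t by (simp add: \<kappa>_def w_def)
    ultimately show "z \<in> \<kappa> ` half_open_square"
      by blast
  qed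
  then have "openin (top_of_set S) (\<kappa> ` half_open_square)"
    using W by (simp add: openin_open_Int)
  moreover have "continuous_on unit_square \<kappa>"
  proof -
    have "continuous_on {0..1} g"
      using g(1) by (simp add: simple_path_def path_def)
    then have "continuous_on unit_square (\<lambda>w. g (Re w))"
      by (rule continuous_on_compose2) (auto simp: unit_square_def intro!: continuous_intros)
    then show ?thesis
      unfolding \<kappa>_def l_def by (intro continuous_intros)
  qed
  moreover have "w = w'" if w: "w \<in> half_open_square" "w' \<in> unit_square" "\<kappa> w = \<kappa> w'" for w w'
  proof -
    have w': "w \<in> unit_square"
      using w half_open_square_subset by blast
    have "Im w = Im w'"
      using depth[OF w'] depth[OF w(2)] w(3) \<epsilon>(1) \<open>0 < r\<close> by simp
    moreover have "g (Re w) = g (Re w')"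
      using cancel[OF w'] cancel[OF w(2)] w(3) by simp
    then have "Re w = Re w'"
      using w by (intro gfree) (auto simp: half_open_square_def unit_square_def)
    ultimately show ?thesis
      by (simp add: complex_eq_iff)
  qed
  moreover have "\<kappa> w = g (Re w)" if "Im w = 0" for w
    using that by (simp add: \<kappa>_def l_def)
  ultimately show thesis
    using that[of \<kappa>] inS notT depth \<epsilon>(1) \<open>0 < r\<close> by (simp add: image_subset_iff)
qed

section \<open>The pairs of pants\<close>

text \<open>The circles of the earring to which the boundary of the \<open>n\<close>th pair of pants is attached.\<close>

definition cuffs :: "nat \<Rightarrow> nat set" where
  "cuffs n = {n, 2 * n, 2 * n + 1}"

context hawaiian_pants_data
begin

abbreviation pants_piece :: "nat \<Rightarrow> complex set" where
  "pants_piece n \<equiv> pair_of_pants (D n) (E n) (F n)"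

definition piece_boundary :: "nat \<Rightarrow> complex set" where
  "piece_boundary n = frontier (D n) \<union> frontier (E n) \<union> frontier (F n)"

text \<open>Boundary components are named by the circle they are attached to, so one collar argument
  serves all three. For \<open>1 \<le> n\<close> the three names differ; the default branch is meant
  for \<open>2 * n + 1\<close>.\<close>

definition cuff_disk :: "nat \<Rightarrow> nat \<Rightarrow> complex set" where
  "cuff_disk n m = (if m = n then D n else if m = 2 * n then E n else F n)"

definition cuff_curve :: "nat \<Rightarrow> nat \<Rightarrow> real \<Rightarrow> complex" where
  "cuff_curve n m = (if m = n then \<alpha> n else if m = 2 * n then \<beta> n else \<gamma> n)"

lemma disk_balls:
  assumes "1 \<le> n"
  obtains c r where "0 < r" "cuff_disk n m = cball c r" "interior (cuff_disk n m) = ball c r"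
    "frontier (cuff_disk n m) = sphere c r"
proof -
  have "closed_disk (cuff_disk n m)"
    using disks[OF assms] by (simp add: cuff_disk_def)
  then show thesis
    using that by (auto simp: closed_disk_def interior_cball frontier_cball)
qed

lemma cuff_disk_simps:
  assumes "1 \<le> n"
  shows "cuff_disk n n = D n" "cuff_disk n (2 * n) = E n" "cuff_disk n (2 * n + 1) = F n"
  using assms by (auto simp: cuff_disk_def)

lemma piece_boundary_eq: "1 \<le> n \<Longrightarrow> piece_boundary n = (\<Union>m\<in>cuffs n. frontier (cuff_disk n m))"
  using cuff_disk_simps by (auto simp: piece_boundary_def cuffs_def)

lemma cuff_curve:
  assumes "1 \<le> n" "m \<in> cuffs n"
  shows "simple_path (cuff_curve n m)" "pathfinish (cuff_curve n m) = pathstart (cuff_curve n m)"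
    "path_image (cuff_curve n m) = frontier (cuff_disk n m)"
    "t \<in> {0..1} \<Longrightarrow> f n (cuff_curve n m t) = earring_loop m t"
proof -
  have "clockwise_boundary_curve (cuff_curve n m) (cuff_disk n m)"
    using assms curve_\<alpha> curve_\<beta> curve_\<gamma> by (auto simp: cuff_curve_def cuff_disk_def cuffs_def)
  then show "simple_path (cuff_curve n m)" "pathfinish (cuff_curve n m) = pathstart (cuff_curve n m)"
      "path_image (cuff_curve n m) = frontier (cuff_disk n m)"
    by (simp_all add: clockwise_boundary_curve_def)
  show "f n (cuff_curve n m t) = earring_loop m t" if "t \<in> {0..1}"
    using assms attach_\<alpha> attach_\<beta> attach_\<gamma> that by (auto simp: cuff_curve_def cuffs_def)
qed

lemma piece_disks:
  assumes "1 \<le> n"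
  shows "closed (D n)" "closed (E n)" "closed (F n)" "bounded (D n)"
    "E n \<subseteq> interior (D n)" "F n \<subseteq> interior (D n)" "E n \<inter> F n = {}"
  using disks[OF assms] inside[OF assms] disjoint[OF assms] by (auto simp: closed_disk_def)

lemma compact_piece:
  assumes "1 \<le> n"
  shows "compact (pants_piece n)"
  unfolding pair_of_pants_def using piece_disks[OF assms]
  by (intro compact_diff) (auto simp: compact_eq_bounded_closed)

lemma closed_piece_boundary: "closed (piece_boundary n)"
  unfolding piece_boundary_def by (intro closed_Un frontier_closed)

lemma piece_boundary_subset:
  assumes "1 \<le> n"
  shows "piece_boundary n \<subseteq> pants_piece n"
  using piece_disks[OF assms] interior_subset[of "D n"] interior_subset[of "E n"] interior_subset[of "F n"]
  unfolding piece_boundary_def pair_of_pants_def frontier_def by (auto simp: closure_closed)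

lemma piece_minus_boundary:
  assumes "1 \<le> n"
  shows "pants_piece n - piece_boundary n = interior (D n) - (E n \<union> F n)"
  using piece_disks[OF assms] interior_subset[of "D n"] interior_subset[of "E n"] interior_subset[of "F n"]
  unfolding piece_boundary_def pair_of_pants_def frontier_def by (auto simp: closure_closed)

lemma open_piece_minus_boundary:
  assumes "1 \<le> n"
  shows "open (pants_piece n - piece_boundary n)"
  using piece_disks[OF assms] by (simp add: piece_minus_boundary[OF assms] open_Diff closed_Un)

text \<open>Together with the two removed disks the piece fills the convex set \<open>D n\<close>,
  and it meets them in two disjoint circles. As union and intersection are absolute neighbourhood
  retracts, so is the closed piece.\<close>

lemma locally_path_connected_piece:
  assumes "1 \<le> n"
  shows "locally path_connected (pants_piece n)"
proof -
  note p = piece_disks[OF assms]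
  obtain c r c1 r1 c2 r2 where balls: "D n = cball c r" "frontier (E n) = sphere c1 r1" "frontier (F n) = sphere c2 r2"
    using disk_balls[OF assms] cuff_disk_simps[OF assms] by metis
  have "closed (pants_piece n)"
    using compact_piece[OF assms] by (rule compact_imp_closed)
  moreover have "closed (E n \<union> F n)"
    using p by (simp add: closed_Un)
  moreover have "pants_piece n \<union> (E n \<union> F n) = D n"
    using p interior_subset[of "D n"] interior_subset[of "E n"] interior_subset[of "F n"]
    by (auto simp: pair_of_pants_def)
  moreover have "pants_piece n \<inter> (E n \<union> F n) = frontier (E n) \<union> frontier (F n)"
    using p interior_subset[of "D n"] interior_subset[of "E n"] interior_subset[of "F n"]
    unfolding pair_of_pants_def frontier_def by (auto simp: closure_closed)
  moreover have "frontier (E n) \<inter> frontier (F n) = {}"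
    using p by (auto simp: frontier_def)
  then have "ANR (frontier (E n) \<union> frontier (F n))"
    by (intro ANR_closed_Un) (auto simp: balls ANR_sphere ANR_empty)
  moreover have "ANR (D n)"
    by (simp add: balls convex_imp_ANR)
  ultimately have "ANR (pants_piece n)"
    using ANR_from_Un_Int[of "pants_piece n" "E n \<union> F n"] by simp
  then show ?thesis
    by (rule ANR_imp_locally_path_connected)
qed

lemma piece_boundary_curveE:
  assumes "1 \<le> n" "x \<in> piece_boundary n"
  obtains m t where "m \<in> cuffs n" "t \<in> {0..1}" "x = cuff_curve n m t" "f n x = earring_loop m t"
    "f n x \<in> earring_circle m"
proof -
  obtain m where m: "m \<in> cuffs n" "x \<in> path_image (cuff_curve n m)"
    using assms cuff_curve(3)[OF assms(1)] by (auto simp: piece_boundary_eq)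
  then obtain t where t: "t \<in> {0..1}" "x = cuff_curve n m t"
    by (auto simp: path_image_def)
  have "1 \<le> m"
    using m(1) assms(1) by (auto simp: cuffs_def)
  then show thesis
    using that[OF m(1) t] cuff_curve(4)[OF assms(1) m(1) t(1)] t earring_loop_image[of m] by blast
qed

lemma attaching_in_earring:
  assumes "1 \<le> n" "x \<in> piece_boundary n"
  shows "f n x \<in> hawaiian_earring"
proof -
  obtain m where "m \<in> cuffs n" "f n x \<in> earring_circle m"
    using piece_boundary_curveE[OF assms] by metis
  then show ?thesis
    using assms(1) by (auto simp: hawaiian_earring_def cuffs_def)
qed

text \<open>Different circles meet only at 0, so the circle containing the image of \<open>x\<close>
  determines the boundary component of \<open>x\<close>, and a nonzero image excludes the end points
  of the parameter interval.\<close>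

lemma attaching_circle:
  assumes "1 \<le> n" "x \<in> piece_boundary n" "1 \<le> m" "f n x \<in> earring_circle m - {0}"
  shows "m \<in> cuffs n \<and> (\<exists>t\<in>{0<..<1}. x = cuff_curve n m t)"
proof -
  obtain k t where k: "k \<in> cuffs n" "t \<in> {0..1}" "x = cuff_curve n k t" "f n x = earring_loop k t"
      "f n x \<in> earring_circle k"
    using piece_boundary_curveE[OF assms(1,2)] by metis
  have "1 \<le> k"
    using k(1) assms(1) by (auto simp: cuffs_def)
  then have "k = m"
    using earring_circle_Int[of k m "f n x"] assms k by auto
  moreover have "t \<noteq> 0" "t \<noteq> 1"
    using assms(4) k \<open>1 \<le> k\<close> earring_loop_eq_0_iff[of k t] by auto
  ultimately show ?thesis
    using k by auto
qed

text \<open>The values of \<open>f n\<close> are prescribed only along the boundary curves.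
  Factoring through these gives continuity on each circle, and three closed circles make up the
  boundary.\<close>

lemma continuous_on_attaching:
  assumes "1 \<le> n"
  shows "continuous_on (piece_boundary n) (f n)"
  unfolding piece_boundary_eq[OF assms]
proof (rule continuous_on_closed_Union)
  fix m assume m: "m \<in> cuffs n"
  note c = cuff_curve[OF assms m]
  have "continuous_on {0..1} (f n \<circ> cuff_curve n m)"
    using continuous_on_earring_loop[of "{0..1}" m] c(4)
    by (subst continuous_on_cong[where g = "earring_loop m"]) auto
  moreover have "continuous_on {0..1} (cuff_curve n m)"
    using c(1) by (simp add: simple_path_def path_def)
  ultimately have "continuous_on (cuff_curve n m ` {0..1}) (f n)"
    by (intro continuous_on_compact_image_factor) auto
  then show "continuous_on (frontier (cuff_disk n m)) (f n)"
    using c(3) by (simp add: path_image_def)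
qed (auto simp: cuffs_def)

text \<open>What remains of a collar once centre, radius and side of the circle are forgotten, so
  that outer and inner cuffs are treated alike. The injectivity clause has the form needed by
  \<open>homeomorphic_map_compact_restriction\<close>.\<close>

definition collar :: "nat \<Rightarrow> nat \<Rightarrow> (complex \<Rightarrow> complex) \<Rightarrow> bool" where
  "collar n m \<kappa> \<longleftrightarrow> continuous_on unit_square \<kappa> \<and> \<kappa> ` unit_square \<subseteq> pants_piece n \<and>
     (\<forall>w\<in>unit_square. Im w = 0 \<longrightarrow> \<kappa> w = cuff_curve n m (Re w)) \<and>
     (\<forall>w\<in>unit_square. 0 < Im w \<longrightarrow> \<kappa> w \<notin> piece_boundary n) \<and>
     (\<forall>w\<in>half_open_square. \<forall>w'\<in>unit_square. \<kappa> w = \<kappa> w' \<longrightarrow> w = w') \<and>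
     openin (top_of_set (pants_piece n)) (\<kappa> ` half_open_square)"

lemma piece_collar:
  assumes n: "1 \<le> n" and m: "m \<in> cuffs n"
  obtains \<kappa> where "collar n m \<kappa>"
proof -
  \<comment> \<open>\<open>T\<close> is what the collar must avoid: the other removed disks and, for
    an inner cuff, everything outside the interior of \<open>D n\<close>. The sign places the collar
    inside the outer circle and outside the inner ones.\<close>
  define T where "T = (if m = n then E n \<union> F n else if m = 2 * n then F n \<union> - interior (D n)
      else E n \<union> - interior (D n))"
  define s :: real where "s = (if m = n then 1 else -1)"
  note p = piece_disks[OF n]
  have frontiers: "frontier (E n) \<subseteq> E n" "frontier (F n) \<subseteq> F n" "frontier (D n) \<subseteq> - interior (D n)"
      "frontier (D n) \<subseteq> D n"
    using p by (auto simp: frontier_def)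
  have interiors: "interior (D n) \<subseteq> D n" "interior (E n) \<subseteq> E n" "interior (F n) \<subseteq> F n"
    by (simp_all add: interior_subset)
  obtain c r where cr: "0 < r" "cuff_disk n m = cball c r" "interior (cuff_disk n m) = ball c r"
      "frontier (cuff_disk n m) = sphere c r"
    using disk_balls[OF n] by metis
  have side: "{z. 0 \<le> s * (r - dist c z)} = (if m = n then D n else - interior (cuff_disk n m))"
  proof (cases "m = n")
    case True
    then show ?thesis
      using cr(2) cuff_disk_simps(1)[OF n] by (auto simp: s_def cball_def)
  next
    case False
    then show ?thesis
      unfolding cr(3) by (auto simp: s_def)
  qed
  have T: "closed T"
    using p by (auto simp: T_def)
  have dis: "sphere c r \<inter> T = {}"
    unfolding cr(4)[symmetric] using p frontiers m n
    by (auto simp: T_def cuff_disk_def cuffs_def)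
  have S1: "pants_piece n \<subseteq> {z. 0 \<le> s * (r - dist c z)}"
    unfolding side using m n by (auto simp: cuff_disk_def cuffs_def pair_of_pants_def)
  have S2: "{z. 0 \<le> s * (r - dist c z)} - T \<subseteq> pants_piece n"
    unfolding side using m n interiors by (auto simp: T_def cuff_disk_def cuffs_def pair_of_pants_def)
  \<comment> \<open>The other two boundary circles lie in \<open>T\<close>, so a collar avoiding
    \<open>T\<close> can meet the boundary of the piece only in its own circle.\<close>
  have sphere: "piece_boundary n \<subseteq> T \<union> sphere c r"
    unfolding cr(4)[symmetric] piece_boundary_def using frontiers m n
    by (auto simp: T_def cuff_disk_def cuffs_def)
  have ss: "s = 1 \<or> s = -1"
    by (simp add: s_def)
  show thesis
  proof (rule circle_collar[OF cuff_curve(1,2)[OF n m] _ cr(1) ss T dis S1 S2])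
    show "path_image (cuff_curve n m) = sphere c r"
      using cuff_curve(3)[OF n m] cr(4) by simp
    fix \<kappa>
    assume \<kappa>: "continuous_on unit_square \<kappa>" "\<kappa> ` unit_square \<subseteq> pants_piece n - T"
      "\<And>w. w \<in> unit_square \<Longrightarrow> Im w = 0 \<Longrightarrow> \<kappa> w = cuff_curve n m (Re w)"
      "\<And>w. w \<in> unit_square \<Longrightarrow> 0 < Im w \<Longrightarrow> 0 < s * (r - dist c (\<kappa> w))"
      "\<And>w w'. w \<in> half_open_square \<Longrightarrow> w' \<in> unit_square \<Longrightarrow> \<kappa> w = \<kappa> w' \<Longrightarrow> w = w'"
      "openin (top_of_set (pants_piece n)) (\<kappa> ` half_open_square)"
    have "\<kappa> w \<notin> piece_boundary n" if "w \<in> unit_square" "0 < Im w" for w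
    proof -
      have "\<kappa> w \<notin> T" "\<kappa> w \<notin> sphere c r"
        using \<kappa>(2) \<kappa>(4)[OF that] that(1) by auto
      then show ?thesis
        using sphere by blast
    qed
    then have "collar n m \<kappa>"
      unfolding collar_def using \<kappa> by blast
    then show thesis
      by (rule that)
  qed
qed

section \<open>The topology of the Hawaiian pants\<close>

abbreviation pants :: "(complex + nat \<times> complex) set topology" where
  "pants \<equiv> hawaiian_pants D E F f"

abbreviation earring_map :: "complex \<Rightarrow> (complex + nat \<times> complex) set" where
  "earring_map \<equiv> earring_inclusion D E F f"

definition piece_map :: "nat \<Rightarrow> complex \<Rightarrow> (complex + nat \<times> complex) set" where
  "piece_map n x = adjunction_class (top_of_set hawaiian_earring) (pants_coproduct D E F)
     (pants_coproduct_boundary D E F) (\<lambda>(n, x). f n x) (Inr (n, x))"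

lemma earring_map_eq:
  "earring_map y = adjunction_class (top_of_set hawaiian_earring) (pants_coproduct D E F)
     (pants_coproduct_boundary D E F) (\<lambda>(n, x). f n x) (Inl y)"
  by (simp add: earring_inclusion_def adjunction_class_def)

lemma mem_pants_coproduct_boundary:
  "(n, x) \<in> pants_coproduct_boundary D E F \<longleftrightarrow> 1 \<le> n \<and> x \<in> piece_boundary n"
  by (auto simp: pants_coproduct_boundary_def piece_boundary_def)

lemma topspace_pants_coproduct:
  "topspace (pants_coproduct D E F) = (SIGMA n:{1..}. pants_piece n)"
  by (auto simp: pants_coproduct_def)

text \<open>The explicit union stands in for the carrier, because this form is what computes
  \<open>topspace pants\<close>.\<close>

lemma openin_pants_image:
  "openin pants U \<longleftrightarrow>
     U \<subseteq> earring_map ` hawaiian_earring \<union> (\<Union>n\<in>{1..}. piece_map n ` pants_piece n) \<and>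
     openin (top_of_set hawaiian_earring) {y \<in> hawaiian_earring. earring_map y \<in> U} \<and>
     (\<forall>n\<ge>1. openin (top_of_set (pants_piece n)) {x \<in> pants_piece n. piece_map n x \<in> U})"
proof -
  let ?cl = "adjunction_class (top_of_set hawaiian_earring) (pants_coproduct D E F)
     (pants_coproduct_boundary D E F) (\<lambda>(n, x). f n x)"
  have image: "?cl ` (topspace (top_of_set hawaiian_earring) <+> topspace (pants_coproduct D E F)) =
      earring_map ` hawaiian_earring \<union> (\<Union>n\<in>{1..}. piece_map n ` pants_piece n)"
    unfolding topspace_pants_coproduct by (force simp: earring_map_eq piece_map_def)
  have "{x. (n, x) \<in> {z \<in> topspace (pants_coproduct D E F). ?cl (Inr z) \<in> U}} =
      {x \<in> pants_piece n. piece_map n x \<in> U}" if "1 \<le> n" for n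
    unfolding topspace_pants_coproduct using that by (auto simp: piece_map_def)
  then have "openin (pants_coproduct D E F) {z \<in> topspace (pants_coproduct D E F). ?cl (Inr z) \<in> U} \<longleftrightarrow>
      (\<forall>n\<ge>1. openin (top_of_set (pants_piece n)) {x \<in> pants_piece n. piece_map n x \<in> U})"
    unfolding pants_coproduct_def openin_sum_topology topspace_sum_topology by auto
  then show ?thesis
    unfolding hawaiian_pants_def openin_adjunction_space image by (simp add: earring_map_eq)
qed

lemma topspace_pants:
  "topspace pants = earring_map ` hawaiian_earring \<union> (\<Union>n\<in>{1..}. piece_map n ` pants_piece n)"
    (is "_ = ?T")
proof
  have "{y \<in> hawaiian_earring. earring_map y \<in> ?T} = hawaiian_earring"
    by auto
  moreover have "{x \<in> pants_piece n. piece_map n x \<in> ?T} = pants_piece n" if "1 \<le> n" for n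
    using that by auto
  ultimately have "openin pants ?T"
    unfolding openin_pants_image by simp
  then show "?T \<subseteq> topspace pants"
    by (rule openin_subset)
  show "topspace pants \<subseteq> ?T"
    using openin_topspace[of pants] unfolding openin_pants_image by blast
qed

lemma openin_pants:
  "openin pants U \<longleftrightarrow> U \<subseteq> topspace pants \<and>
     openin (top_of_set hawaiian_earring) {y \<in> hawaiian_earring. earring_map y \<in> U} \<and>
     (\<forall>n\<ge>1. openin (top_of_set (pants_piece n)) {x \<in> pants_piece n. piece_map n x \<in> U})"
  unfolding topspace_pants by (rule openin_pants_image)

lemma continuous_map_earring_map: "continuous_map (top_of_set hawaiian_earring) pants earring_map"
  unfolding continuous_map_def by (auto simp: openin_pants topspace_pants)

lemma continuous_map_piece_map:
  "1 \<le> n \<Longrightarrow> continuous_map (top_of_set (pants_piece n)) pants (piece_map n)"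
  unfolding continuous_map_def by (auto simp: openin_pants topspace_pants)

lemma earring_map_eq_iff:
  "y \<in> hawaiian_earring \<Longrightarrow> y' \<in> hawaiian_earring \<Longrightarrow> earring_map y = earring_map y' \<longleftrightarrow> y = y'"
  unfolding earring_map_eq by (subst adjunction_class_eq_iff) auto

lemma piece_map_boundary:
  assumes "1 \<le> n" "x \<in> piece_boundary n"
  shows "piece_map n x = earring_map (f n x)"
  unfolding earring_map_eq piece_map_def
  using assms piece_boundary_subset attaching_in_earring
  by (subst adjunction_class_eq_iff) (auto simp: topspace_pants_coproduct mem_pants_coproduct_boundary)

lemma piece_map_neq_earring_map:
  assumes "1 \<le> n" "x \<in> pants_piece n - piece_boundary n" "y \<in> hawaiian_earring"
  shows "piece_map n x \<noteq> earring_map y"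
  unfolding earring_map_eq piece_map_def using assms
  by (subst adjunction_class_eq_iff) (auto simp: topspace_pants_coproduct mem_pants_coproduct_boundary)

lemma piece_map_eq_iff:
  assumes "1 \<le> n" "x \<in> pants_piece n - piece_boundary n" "1 \<le> n'" "x' \<in> pants_piece n' - piece_boundary n'"
  shows "piece_map n x = piece_map n' x' \<longleftrightarrow> n = n' \<and> x = x'"
  unfolding piece_map_def using assms
  by (subst adjunction_class_eq_iff) (auto simp: topspace_pants_coproduct mem_pants_coproduct_boundary)

lemma topspace_pants_cases:
  assumes "p \<in> topspace pants"
  obtains (earring) y where "y \<in> hawaiian_earring" "p = earring_map y"
    | (piece) n x where "1 \<le> n" "x \<in> pants_piece n - piece_boundary n" "p = piece_map n x"
proof -
  consider (1) y where "y \<in> hawaiian_earring" "p = earring_map y"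
    | (2) n x where "1 \<le> n" "x \<in> pants_piece n" "p = piece_map n x"
    using assms unfolding topspace_pants by auto
  then show thesis
  proof cases
    case 1
    then show thesis
      by (rule earring)
  next
    case (2 n x)
    then show thesis
      using earring[of "f n x"] piece[of n x] attaching_in_earring piece_map_boundary by blast
  qed
qed


text \<open>The universal property of the gluing. Compatibility is required only between a piece and
  the earring, never between two pieces.\<close>

lemma pants_function:
  fixes a :: "complex \<Rightarrow> 'b::topological_space"
  assumes a: "continuous_on hawaiian_earring a"
    and b: "\<And>n. 1 \<le> n \<Longrightarrow> continuous_on (pants_piece n) (b n)"
    and ab: "\<And>n x. 1 \<le> n \<Longrightarrow> x \<in> piece_boundary n \<Longrightarrow> b n x = a (f n x)"
  obtains g where "continuous_map pants euclidean g"
    "\<And>y. y \<in> hawaiian_earring \<Longrightarrow> g (earring_map y) = a y"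
    "\<And>n x. 1 \<le> n \<Longrightarrow> x \<in> pants_piece n \<Longrightarrow> g (piece_map n x) = b n x"
proof -
  \<comment> \<open>Only interior points enter \<open>J\<close>: there the class determines both the
    piece and the point, so the inverse is well defined.\<close>
  define J where "J = (SIGMA n:{1..}. pants_piece n - piece_boundary n)"
  define g where "g p = (if p \<in> earring_map ` hawaiian_earring then a (inv_into hawaiian_earring earring_map p)
    else case_prod b (inv_into J (case_prod piece_map) p))" for p
  have g1: "g (earring_map y) = a y" if "y \<in> hawaiian_earring" for y
    using that by (simp add: g_def inj_on_def earring_map_eq_iff)
  have "inj_on (case_prod piece_map) J"
    using piece_map_eq_iff by (auto simp: inj_on_def J_def)
  then have g2: "g (piece_map n x) = b n x" if n: "1 \<le> n" "x \<in> pants_piece n" for n x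
  proof (cases "x \<in> piece_boundary n")
    case True
    then show ?thesis
      using n(1) piece_map_boundary g1 attaching_in_earring ab by simp
  next
    case False
    then have "piece_map n x \<notin> earring_map ` hawaiian_earring"
      using n piece_map_neq_earring_map by auto
    moreover have "inv_into J (case_prod piece_map) (case_prod piece_map (n, x)) = (n, x)"
      using \<open>inj_on _ J\<close> n False by (intro inv_into_f_f) (auto simp: J_def)
    ultimately show ?thesis
      by (simp add: g_def)
  qed
  have "continuous_map pants euclidean g"
    unfolding continuous_map_def
  proof (intro conjI allI impI)
    fix U :: "'b set" assume "openin euclidean U"
    then have U: "open U"
      by simp
    have "{y \<in> hawaiian_earring. earring_map y \<in> {p \<in> topspace pants. g p \<in> U}} = hawaiian_earring \<inter> a -` U"
      using g1 by (auto simp: topspace_pants)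
    moreover have "{x \<in> pants_piece n. piece_map n x \<in> {p \<in> topspace pants. g p \<in> U}} = pants_piece n \<inter> b n -` U"
      if "1 \<le> n" for n
      using g2[OF that] that by (auto simp: topspace_pants)
    ultimately show "openin pants {p \<in> topspace pants. g p \<in> U}"
      unfolding openin_pants using a b U by (auto intro: continuous_openin_preimage_gen)
  qed auto
  then show thesis
    using that g1 g2 by blast
qed

text \<open>An extension of the inclusion of the earring into the
  plane separates the points of the earring, and on the \<open>n\<close>th piece \<open>x \<mapsto> (d x, d x * x)\<close>, where \<open>d\<close>
  is the distance to the boundary, extends by zero and separates its interior points from all others.\<close>

lemma Hausdorff_pants: "Hausdorff_space pants"
  unfolding Hausdorff_space_def
proof (intro allI impI, elim conjE)
  fix p q assume pq: "p \<in> topspace pants" "q \<in> topspace pants" "p \<noteq> q"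
  \<comment> \<open>Stated for fresh points, so that it can also be applied with the two given
    points exchanged.\<close>
  have sep: "\<exists>g :: _ \<Rightarrow> real \<times> complex. continuous_map pants euclidean g \<and> g p \<noteq> g q"
    if "1 \<le> n" "x \<in> pants_piece n - piece_boundary n" "p = piece_map n x" "q \<in> topspace pants" "p \<noteq> q" for p q n x
  proof -
    define d where "d x = infdist x (piece_boundary n)" for x
    have cont: "continuous_on A (\<lambda>x. (d x, d x *\<^sub>R x))" for A
      unfolding d_def by (intro continuous_intros)
    have boundary: "d x = 0 \<longleftrightarrow> x \<in> piece_boundary n" if "piece_boundary n \<noteq> {}" for x
      using that closed_piece_boundary by (simp add: d_def in_closed_iff_infdist_zero)
    have nonempty: "piece_boundary n \<noteq> {}"
      using disk_balls[OF that(1), of n] cuff_disk_simps(1)[OF that(1)]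
      by (metis Un_empty less_imp_le piece_boundary_def sphere_eq_empty not_le)
    obtain g :: "_ \<Rightarrow> real \<times> complex" where g: "continuous_map pants euclidean g"
      "\<And>y. y \<in> hawaiian_earring \<Longrightarrow> g (earring_map y) = 0"
      "\<And>k x. 1 \<le> k \<Longrightarrow> x \<in> pants_piece k \<Longrightarrow> g (piece_map k x) = (if k = n then (d x, d x *\<^sub>R x) else 0)"
    proof (rule pants_function[of "\<lambda>_. 0" "\<lambda>k x. if k = n then (d x, d x *\<^sub>R x) else 0"])
      show "continuous_on (pants_piece k) (\<lambda>x. if k = n then (d x, d x *\<^sub>R x) else 0)" for k
        using cont by (cases "k = n") auto
    qed (use boundary nonempty in \<open>auto simp: zero_prod_def\<close>)
    have dx: "d x \<noteq> 0"
      using that(2) boundary nonempty by auto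
    have "g p \<noteq> g q"
      using \<open>q \<in> topspace pants\<close>
    proof (cases rule: topspace_pants_cases)
      case (earring y)
      then show ?thesis
        using that g dx by (auto simp: zero_prod_def)
    next
      case (piece k y)
      then show ?thesis
        using that g(3)[of n x] g(3)[of k y] dx by (auto simp: zero_prod_def split: if_splits)
    qed
    then show ?thesis
      using g(1) by blast
  qed
  show "\<exists>U V. openin pants U \<and> openin pants V \<and> p \<in> U \<and> q \<in> V \<and> disjnt U V"
    using pq(1)
  proof (cases rule: topspace_pants_cases)
    case (piece n x)
    then show ?thesis
    proof -
      obtain g :: "_ \<Rightarrow> real \<times> complex" where "continuous_map pants euclidean g" "g p \<noteq> g q"
        using sep[OF piece pq(2,3)] by blast
      then show ?thesis
        using pq by (intro separate_by_continuous_map)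
    qed
  next
    case (earring y)
    note y = this
    show ?thesis
      using pq(2)
    proof (cases rule: topspace_pants_cases)
      case (piece n x)
      then show ?thesis
      proof -
        obtain g :: "_ \<Rightarrow> real \<times> complex" where "continuous_map pants euclidean g" "g q \<noteq> g p"
          using sep[OF piece pq(1)] pq(3) by blast
        then show ?thesis
          using pq by (intro separate_by_continuous_map) auto
      qed
    next
      case (earring z)
      \<comment> \<open>Pieces meet each other only through the earring, so the attaching maps can
        be extended by Tietze one piece at a time.\<close>
      have "\<forall>n\<in>{1..}. \<exists>h. continuous_on (pants_piece n) h \<and> (\<forall>x\<in>piece_boundary n. h x = f n x)"
      proof
        fix n :: nat assume "n \<in> {1..}"
        then have "1 \<le> n"
          by simp
        moreover have "closedin (top_of_set (pants_piece n)) (piece_boundary n)"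
          using \<open>1 \<le> n\<close> closed_piece_boundary piece_boundary_subset by (simp add: closed_subset)
        ultimately show "\<exists>h. continuous_on (pants_piece n) h \<and> (\<forall>x\<in>piece_boundary n. h x = f n x)"
          using Tietze_unbounded[OF continuous_on_attaching] by metis
      qed
      then obtain h where h: "\<And>n. 1 \<le> n \<Longrightarrow> continuous_on (pants_piece n) (h n)"
          "\<And>n x. 1 \<le> n \<Longrightarrow> x \<in> piece_boundary n \<Longrightarrow> h n x = f n x"
        by (metis atLeast_iff)
      obtain g where "continuous_map pants euclidean g"
          "\<And>y. y \<in> hawaiian_earring \<Longrightarrow> g (earring_map y) = y"
        by (rule pants_function[of "\<lambda>y. y" h]) (use h in auto)
      then show ?thesis
        using y earring pq by (intro separate_by_continuous_map[of pants g]) auto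
    qed
  qed
qed

section \<open>Connectedness\<close>

lemma locally_path_connected_pants: "locally_path_connected_space pants"
  unfolding locally_path_connected_space_open_path_components
proof (intro allI impI, elim conjE)
  fix U C assume UC: "openin pants U" "C \<in> path_components_of (subtopology pants U)"
  have "C \<subseteq> topspace pants"
    using path_components_of_subset[OF UC(2)] by simp
  then show "openin pants C"
    unfolding openin_pants
    using openin_preimage_path_component[OF locally_path_connected_earring continuous_map_earring_map UC]
      openin_preimage_path_component[OF locally_path_connected_piece continuous_map_piece_map UC] by blast
qed

text \<open>A horizontal segment from an interior point of a piece to its first frontier point stays
  in the piece and joins the point to the image of the connected earring.\<close>

lemma connected_pants: "connected_space pants"
proof (rule connected_space_subset_family)
  fix p assume "p \<in> topspace pants"
  have H: "connectedin pants (earring_map ` hawaiian_earring)"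
    using connected_earring
    by (intro connectedin_continuous_map_image[OF continuous_map_earring_map]) (simp add: connectedin_subtopology)
  have 0: "earring_map 0 \<in> earring_map ` hawaiian_earring"
    using zero_in_earring by blast
  from \<open>p \<in> topspace pants\<close> show "\<exists>S. connectedin pants S \<and> earring_map 0 \<in> S \<and> p \<in> S"
  proof (cases rule: topspace_pants_cases)
    case (earring y)
    then show ?thesis
      using H 0 by blast
  next
    case (piece n x)
    have "x \<in> interior (pants_piece n)"
      using open_piece_minus_boundary[OF piece(1)] piece(2) by (meson Diff_subset interiorI)
    then obtain d where d: "0 < d" "x + d *\<^sub>R 1 \<in> frontier (pants_piece n)"
        "\<And>e. 0 \<le> e \<Longrightarrow> e < d \<Longrightarrow> x + e *\<^sub>R 1 \<in> interior (pants_piece n)"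
      using ray_to_frontier[of "pants_piece n" x 1] compact_piece[OF piece(1)] compact_imp_bounded by (metis zero_neq_one)
    define L where "L = (\<lambda>e. x + e *\<^sub>R 1) ` {0..d}"
    \<comment> \<open>The piece without its boundary circles is open, so a point of the piece
      outside its interior lies on one of them.\<close>
    have bd: "x + d *\<^sub>R 1 \<in> piece_boundary n"
    proof -
      have "x + d *\<^sub>R 1 \<in> pants_piece n" "x + d *\<^sub>R 1 \<notin> interior (pants_piece n)"
        using d(2) compact_imp_closed[OF compact_piece[OF piece(1)]] by (auto simp: frontier_def)
      then show ?thesis
        using open_piece_minus_boundary[OF piece(1)] by (meson Diff_iff Diff_subset interiorI)
    qed
    have "x + e *\<^sub>R 1 \<in> pants_piece n" if "0 \<le> e" "e \<le> d" for e
      using d(3)[of e] that bd piece_boundary_subset[OF piece(1)] interior_subset[of "pants_piece n"]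
      by (cases "e = d") auto
    then have "L \<subseteq> pants_piece n"
      by (auto simp: L_def)
    moreover have "connected L"
      unfolding L_def by (intro connected_continuous_image continuous_intros) simp
    ultimately have "connectedin pants (piece_map n ` L)"
      by (intro connectedin_continuous_map_image[OF continuous_map_piece_map[OF piece(1)]])
        (simp add: connectedin_subtopology)
    moreover have "piece_map n (x + d *\<^sub>R 1) \<in> piece_map n ` L"
      using d(1) by (auto simp: L_def)
    then have "earring_map ` hawaiian_earring \<inter> piece_map n ` L \<noteq> {}"
      using piece_map_boundary[OF piece(1) bd] attaching_in_earring[OF piece(1) bd] by auto
    ultimately have "connectedin pants (earring_map ` hawaiian_earring \<union> piece_map n ` L)"
      using H by (intro connectedin_Un)
    moreover have "p \<in> piece_map n ` L"
      using piece(3) d(1) by (force simp: L_def)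
    ultimately show ?thesis
      using 0 by blast
  qed
qed

section \<open>Charts of the Hawaiian pants\<close>

lemma openin_piece_interior:
  assumes "1 \<le> n"
  shows "openin pants (piece_map n ` (pants_piece n - piece_boundary n))" (is "openin pants ?U")
proof -
  have earring: "{y \<in> hawaiian_earring. earring_map y \<in> ?U} = {}"
    using piece_map_neq_earring_map[OF assms] by (auto simp: image_iff)
  have piece: "{x \<in> pants_piece k. piece_map k x \<in> ?U} = (if k = n then pants_piece n - piece_boundary n else {})"
    if k: "1 \<le> k" for k
  proof -
    have "x \<notin> piece_boundary k" if "piece_map k x \<in> ?U" for x
    proof
      assume "x \<in> piece_boundary k"
      then have "piece_map k x = earring_map (f k x)" "f k x \<in> hawaiian_earring"
        using k piece_map_boundary attaching_in_earring by auto
      then show False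
        using that piece_map_neq_earring_map[OF assms] by auto
    qed
    then have "x \<in> pants_piece k \<and> piece_map k x \<in> ?U \<longleftrightarrow> k = n \<and> x \<in> pants_piece n - piece_boundary n" for x
      using piece_map_eq_iff[OF k _ assms] by blast
    then show ?thesis
      by auto
  qed
  have "openin (top_of_set (pants_piece n)) (pants_piece n - piece_boundary n)"
    unfolding Diff_eq using closed_piece_boundary by (intro openin_open_Int) auto
  moreover have "?U \<subseteq> topspace pants"
    using assms by (auto simp: topspace_pants)
  ultimately show ?thesis
    unfolding openin_pants earring using piece by simp
qed

lemma piece_interior_chart:
  assumes "1 \<le> n"
  shows "homeomorphic_map (top_of_set (pants_piece n - piece_boundary n))
    (subtopology pants (piece_map n ` (pants_piece n - piece_boundary n))) (piece_map n)"
proof (rule homeomorphic_map_compact_restriction[OF Hausdorff_pants compact_piece[OF assms] continuous_map_piece_map[OF assms]])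
  fix x x' assume x: "x \<in> pants_piece n - piece_boundary n" "x' \<in> pants_piece n" "piece_map n x = piece_map n x'"
  show "x = x'"
  proof (cases "x' \<in> piece_boundary n")
    case True
    then show ?thesis
      using x piece_map_neq_earring_map[OF assms x(1)] piece_map_boundary[OF assms] attaching_in_earring[OF assms] by metis
  next
    case False
    then show ?thesis
      using x piece_map_eq_iff assms by auto
  qed
qed auto

lemma collarD:
  assumes "collar n m \<kappa>" "1 \<le> n" "m \<in> cuffs n" "w \<in> unit_square"
  shows "Im w = 0 \<Longrightarrow> piece_map n (\<kappa> w) = earring_map (earring_loop m (Re w))"
    and "0 < Im w \<Longrightarrow> \<kappa> w \<in> pants_piece n - piece_boundary n"
proof -
  assume "Im w = 0"
  then have w: "\<kappa> w = cuff_curve n m (Re w)"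
    using assms by (simp add: collar_def)
  have Re: "Re w \<in> {0..1}"
    using assms(4) by (simp add: unit_square_def)
  then have "\<kappa> w \<in> piece_boundary n"
    unfolding w piece_boundary_eq[OF assms(2)] using assms(3) cuff_curve(3)[OF assms(2,3)]
    by (auto simp: path_image_def)
  then show "piece_map n (\<kappa> w) = earring_map (earring_loop m (Re w))"
    using piece_map_boundary[OF assms(2)] cuff_curve(4)[OF assms(2,3) Re] w by simp
next
  show "0 < Im w \<Longrightarrow> \<kappa> w \<in> pants_piece n - piece_boundary n"
    using assms by (auto simp: collar_def)
qed

text \<open>A neighbourhood of an open arc of the circle must contain a collar in every piece
  attached there, hence the union. Openness is then tested on the earring, where the trace is the
  punctured circle, and on each piece, where it is one collar or empty.\<close>

lemma collar_neighbourhood: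
  assumes m: "1 \<le> m" and \<kappa>: "\<And>n. 1 \<le> n \<Longrightarrow> m \<in> cuffs n \<Longrightarrow> collar n m (\<kappa> n)"
  defines "U \<equiv> \<Union>n\<in>{n. 1 \<le> n \<and> m \<in> cuffs n}. piece_map n ` \<kappa> n ` half_open_square"
  shows "openin pants U" "{y \<in> hawaiian_earring. earring_map y \<in> U} = earring_circle m - {0}"
proof -
  \<comment> \<open>The bottom side of a collar is represented in the earring and the rest in the
    interior of a piece; equality of classes is decided differently in these two cases.\<close>
  have U_E: thesis if p: "p \<in> U"
      "\<And>t. t \<in> {0<..<1} \<Longrightarrow> p = earring_map (earring_loop m t) \<Longrightarrow> thesis"
      "\<And>n w. 1 \<le> n \<Longrightarrow> m \<in> cuffs n \<Longrightarrow> w \<in> half_open_square \<Longrightarrow>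
         \<kappa> n w \<in> pants_piece n - piece_boundary n \<Longrightarrow> p = piece_map n (\<kappa> n w) \<Longrightarrow> thesis" for p thesis
  proof -
    obtain n w where n: "1 \<le> n" "m \<in> cuffs n" and w: "w \<in> half_open_square" "p = piece_map n (\<kappa> n w)"
      using p by (auto simp: U_def)
    have w': "w \<in> unit_square"
      using w half_open_square_subset by blast
    note c = collarD[OF \<kappa>[OF n] n w']
    show thesis
    proof (cases "Im w = 0")
      case True
      then show thesis
        using that(2)[of "Re w"] c(1) w by (auto simp: half_open_square_def)
    next
      case False
      then show thesis
        using that(3)[OF n w(1) _ w(2)] c(2) w by (auto simp: half_open_square_def)
    qed
  qed
  have mm: "m \<in> cuffs m"
    by (simp add: cuffs_def)
  have loop_U: "earring_map (earring_loop m t) \<in> U" if "t \<in> {0<..<1}" for t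
  proof -
    have w: "Complex t 0 \<in> half_open_square"
      using that by (simp add: half_open_square_def)
    then have "earring_map (earring_loop m t) = piece_map m (\<kappa> m (Complex t 0))"
      using collarD(1)[OF \<kappa>[OF m mm] m mm, of "Complex t 0"] half_open_square_subset by auto
    then show ?thesis
      using w m mm by (auto simp: U_def)
  qed
  show H: "{y \<in> hawaiian_earring. earring_map y \<in> U} = earring_circle m - {0}"
  proof (intro equalityI subsetI)
    fix y assume y: "y \<in> {y \<in> hawaiian_earring. earring_map y \<in> U}"
    then have "earring_map y \<in> U"
      by simp
    then show "y \<in> earring_circle m - {0}"
    proof (rule U_E)
      fix t :: real assume t: "t \<in> {0<..<1}" "earring_map y = earring_map (earring_loop m t)"
      then have "y = earring_loop m t"
        using y earring_map_eq_iff[of y "earring_loop m t"] earring_loop_in_earring[OF m, of t] by auto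
      then show ?thesis
        using earring_circle_minus_0[OF m] t(1) by blast
    next
      fix n w assume "1 \<le> n" "\<kappa> n w \<in> pants_piece n - piece_boundary n" "earring_map y = piece_map n (\<kappa> n w)"
      then show ?thesis
        using y piece_map_neq_earring_map by (metis (no_types, lifting) mem_Collect_eq)
    qed
  next
    fix y assume "y \<in> earring_circle m - {0}"
    then show "y \<in> {y \<in> hawaiian_earring. earring_map y \<in> U}"
      using loop_U m unfolding earring_circle_minus_0[OF m] by (auto intro: earring_loop_in_earring)
  qed
  have pieces: "{x \<in> pants_piece k. piece_map k x \<in> U} = (if m \<in> cuffs k then \<kappa> k ` half_open_square else {})"
    if k: "1 \<le> k" for k
  proof -
    have "m \<in> cuffs k \<and> x \<in> \<kappa> k ` half_open_square" if x: "x \<in> pants_piece k" "piece_map k x \<in> U" for x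
    proof (cases "x \<in> piece_boundary k")
      case True
      \<comment> \<open>The class of \<open>x\<close> may have entered \<open>U\<close> through the
        collar of another piece. Passing through the earring shows that \<open>x\<close> also lies
        on the bottom side of its own collar.\<close>
      then have "f k x \<in> earring_circle m - {0}"
        unfolding H[symmetric] using x k piece_map_boundary attaching_in_earring by auto
      then obtain t where t: "m \<in> cuffs k" "t \<in> {0<..<1}" "x = cuff_curve k m t"
        using attaching_circle[OF k True m] by blast
      have w: "Complex t 0 \<in> half_open_square"
        using t by (simp add: half_open_square_def)
      then have "\<kappa> k (Complex t 0) = x"
        using \<kappa>[OF k t(1)] half_open_square_subset t(3) by (auto simp: collar_def)
      then show ?thesis
        using t(1) w by blast
    next
      case False
      then have x': "x \<in> pants_piece k - piece_boundary k"
        using x by blast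
      show ?thesis
        using x(2)
      proof (rule U_E)
        fix t :: real assume "t \<in> {0<..<1}" "piece_map k x = earring_map (earring_loop m t)"
        then show ?thesis
          using piece_map_neq_earring_map[OF k x'] earring_loop_in_earring[OF m, of t] by auto
      next
        fix n w assume "1 \<le> n" "m \<in> cuffs n" "w \<in> half_open_square"
          "\<kappa> n w \<in> pants_piece n - piece_boundary n" "piece_map k x = piece_map n (\<kappa> n w)"
        then show ?thesis
          using piece_map_eq_iff[OF k x'] by blast
      qed
    qed
    moreover have "\<kappa> k ` half_open_square \<subseteq> {x \<in> pants_piece k. piece_map k x \<in> U}" if "m \<in> cuffs k"
      using \<kappa>[OF k that] k that half_open_square_subset by (fastforce simp: collar_def U_def)
    ultimately show ?thesis
      by auto
  qed
  have "U \<subseteq> topspace pants"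
  proof
    fix p assume "p \<in> U"
    then show "p \<in> topspace pants"
      using earring_loop_in_earring[OF m] by (elim U_E) (auto simp: topspace_pants)
  qed
  then show "openin pants U"
    unfolding openin_pants H using openin_earring_circle_minus_0[OF m] pieces \<kappa> by (auto simp: collar_def)
qed


text \<open>Both \<open>2 * n\<close> and \<open>2 * n + 1\<close> exceed 1, so only the outer curve
  of the first piece is attached to this circle. Its collar alone is a neighbourhood, and its bottom
  side becomes the boundary line.\<close>

lemma boundary_cuff_chart:
  obtains V \<psi> where "openin (top_of_set half_plane) V" "openin pants (\<psi> ` V)"
    "homeomorphic_map (top_of_set V) (subtopology pants (\<psi> ` V)) \<psi>"
    "{y \<in> hawaiian_earring. earring_map y \<in> \<psi> ` V} = earring_circle 1 - {0}"
    "\<And>y. y \<in> earring_circle 1 - {0} \<Longrightarrow> \<exists>w\<in>V. Im w = 0 \<and> earring_map y = \<psi> w"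
proof -
  have cuffs1: "{n. 1 \<le> n \<and> 1 \<in> cuffs n} = {1}"
    by (auto simp: cuffs_def)
  then have c1: "1 \<in> cuffs 1"
    by blast
  obtain \<kappa> where \<kappa>: "collar 1 1 \<kappa>"
    using piece_collar[OF le_refl c1] by blast
  define \<psi> where "\<psi> = piece_map 1 \<circ> \<kappa>"
  have coll: "collar n 1 \<kappa>" if "1 \<le> n" "1 \<in> cuffs n" for n
  proof -
    have "n = 1"
      using that cuffs1 by blast
    then show ?thesis
      using \<kappa> by simp
  qed
  have image: "(\<Union>n\<in>{n. 1 \<le> n \<and> 1 \<in> cuffs n}. piece_map n ` \<kappa> ` half_open_square) = \<psi> ` half_open_square"
    unfolding cuffs1 by (simp add: \<psi>_def image_comp)
  note nbhd = collar_neighbourhood[of 1 "\<lambda>_. \<kappa>", OF le_refl coll, unfolded image]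
  have bottom: "\<psi> w = earring_map (earring_loop 1 (Re w))" if "w \<in> unit_square" "Im w = 0" for w
    using collarD(1)[OF \<kappa> le_refl c1 that] by (simp add: \<psi>_def)
  have interior: "\<kappa> w \<in> pants_piece 1 - piece_boundary 1" if "w \<in> unit_square" "Im w \<noteq> 0" for w
    using collarD(2)[OF \<kappa> le_refl c1 that(1)] that by (auto simp: unit_square_def)
  have loop: "earring_loop 1 (Re w) \<in> hawaiian_earring" if "w \<in> unit_square" for w
    using that by (intro earring_loop_in_earring) (auto simp: unit_square_def)
  show thesis
  proof (rule that[of half_open_square \<psi>])
    have square: "half_open_square = half_plane \<inter> ({w. 0 < Re w} \<inter> {w. Re w < 1} \<inter> {w. Im w < 1})"
      by (auto simp: half_open_square_def half_plane_def)
    show "openin (top_of_set half_plane) half_open_square"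
      unfolding square
      by (intro openin_open_Int open_Int open_halfspace_Re_gt open_halfspace_Re_lt open_halfspace_Im_lt)
    show "openin pants (\<psi> ` half_open_square)"
        "{y \<in> hawaiian_earring. earring_map y \<in> \<psi> ` half_open_square} = earring_circle 1 - {0}"
      using nbhd by blast+
    have closed_square: "unit_square = cbox 0 (Complex 1 1)"
      by (auto simp: unit_square_def in_cbox_complex_iff)
    have "compact unit_square"
      unfolding closed_square by (rule compact_cbox)
    then show "homeomorphic_map (top_of_set half_open_square) (subtopology pants (\<psi> ` half_open_square)) \<psi>"
    proof (rule homeomorphic_map_compact_restriction[OF Hausdorff_pants])
      show "continuous_map (top_of_set unit_square) pants \<psi>"
        unfolding \<psi>_def using \<kappa> continuous_map_piece_map[OF le_refl]
        by (intro continuous_map_compose[of _ "top_of_set (pants_piece 1)"]) (auto simp: collar_def)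
      show "half_open_square \<subseteq> unit_square"
        by (rule half_open_square_subset)
      fix w w' assume w: "w \<in> half_open_square" "w' \<in> unit_square" "\<psi> w = \<psi> w'"
      have w1: "w \<in> unit_square"
        using w half_open_square_subset by blast
      consider "Im w = 0" "Im w' = 0" | "Im w \<noteq> 0" "Im w' \<noteq> 0" | "Im w = 0 \<longleftrightarrow> Im w' \<noteq> 0"
        by blast
      then show "w = w'"
      proof cases
        case 1
        then have "earring_loop 1 (Re w) = earring_loop 1 (Re w')"
          using bottom w w1 loop by (metis earring_map_eq_iff)
        then have "Re w = Re w'"
          using w by (intro earring_loop_inject[of 1]) (auto simp: half_open_square_def unit_square_def)
        then show ?thesis
          using 1 by (simp add: complex_eq_iff)
      next
        case 2
        then have "\<kappa> w = \<kappa> w'"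
          using interior w w1 piece_map_eq_iff by (auto simp: \<psi>_def)
        then show ?thesis
          using w \<kappa> by (auto simp: collar_def)
      next
        case 3
        have "\<psi> u \<noteq> \<psi> v" if "u \<in> unit_square" "v \<in> unit_square" "Im u = 0" "Im v \<noteq> 0" for u v
          using piece_map_neq_earring_map[OF le_refl interior[OF that(2,4)] loop[OF that(1)]]
            bottom[OF that(1,3)] by (simp add: \<psi>_def)
        then show ?thesis
          using 3 w w1 by metis
      qed
    qed
    fix y assume "y \<in> earring_circle 1 - {0}"
    then obtain t where t: "t \<in> {0<..<1}" "y = earring_loop 1 t"
      using earring_circle_minus_0[OF le_refl] by blast
    then show "\<exists>w\<in>half_open_square. Im w = 0 \<and> earring_map y = \<psi> w"
      using bottom[of "Complex t 0"]
      by (intro bexI[of _ "Complex t 0"]) (auto simp: half_open_square_def unit_square_def)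
  qed
qed

text \<open>The upper half of the strip is the collar of the outer cuff of piece \<open>m\<close>,
  the lower half the reflected collar of an inner cuff of piece \<open>m div 2\<close>. Both follow
  \<open>earring_loop m\<close> along the middle line, so they fit together without
  reparametrisation.\<close>

lemma interior_cuff_chart:
  assumes "2 \<le> m"
  obtains V :: "complex set" and \<psi> where "open V" "bounded V" "openin pants (\<psi> ` V)"
    "homeomorphic_map (top_of_set V) (subtopology pants (\<psi> ` V)) \<psi>"
    "{y \<in> hawaiian_earring. earring_map y \<in> \<psi> ` V} = earring_circle m - {0}"
proof -
  define k where "k = m div 2"
  have m: "1 \<le> m" and k: "1 \<le> k" "k \<noteq> m"
    using assms by (auto simp: k_def)
  have cuffs: "{n. 1 \<le> n \<and> m \<in> cuffs n} = {m, k}"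
    using m k by (auto simp: cuffs_def k_def)
  then have mm: "m \<in> cuffs m" and mk: "m \<in> cuffs k"
    by blast+
  have "\<exists>\<kappa>. collar n m \<kappa>" if "1 \<le> n \<and> m \<in> cuffs n" for n
    using piece_collar[of n m] that by blast
  then obtain \<kappa> where coll: "\<And>n. 1 \<le> n \<Longrightarrow> m \<in> cuffs n \<Longrightarrow> collar n m (\<kappa> n)"
    by metis
  have \<kappa>: "collar n m (\<kappa> n)" if "n \<in> {m, k}" for n
    using coll cuffs that by blast
  define K where "K = cbox (Complex 0 (-1)) (Complex 1 1)"
  define V where "V = box (Complex 0 (-1)) (Complex 1 1)"
  have K: "w \<in> K \<longleftrightarrow> 0 \<le> Re w \<and> Re w \<le> 1 \<and> -1 \<le> Im w \<and> Im w \<le> 1" for w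
    by (auto simp: K_def in_cbox_complex_iff)
  have V: "w \<in> V \<longleftrightarrow> 0 < Re w \<and> Re w < 1 \<and> -1 < Im w \<and> Im w < 1" for w
    by (auto simp: V_def in_box_complex_iff)
  define \<psi> where "\<psi> w = (if 0 \<le> Im w then piece_map m (\<kappa> m w) else piece_map k (\<kappa> k (cnj w)))" for w
  have up: "\<psi> w = piece_map m (\<kappa> m w)" "\<kappa> m w \<in> pants_piece m - piece_boundary m"
    if "w \<in> K" "0 < Im w" for w
    using that collarD(2)[OF \<kappa> m mm, of w] by (auto simp: \<psi>_def K unit_square_def)
  have down: "\<psi> w = piece_map k (\<kappa> k (cnj w))" "\<kappa> k (cnj w) \<in> pants_piece k - piece_boundary k"
    if "w \<in> K" "Im w < 0" for w
    using that collarD(2)[OF \<kappa> k(1) mk, of "cnj w"] by (auto simp: \<psi>_def K unit_square_def)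
  have middle: "piece_map n (\<kappa> n w) = earring_map (earring_loop m (Re w))"
    if "n \<in> {m, k}" "w \<in> unit_square" "Im w = 0" for n w
    using that cuffs collarD(1)[OF \<kappa>, of n w] by blast
  have mid: "\<psi> w = earring_map (earring_loop m (Re w))" if "w \<in> K" "Im w = 0" for w
    using that middle[of m w] by (auto simp: \<psi>_def K unit_square_def)
  have loop: "earring_loop m (Re w) \<in> hawaiian_earring" if "w \<in> K" for w
    using that m by (intro earring_loop_in_earring) (auto simp: K)
  have image: "(\<Union>n\<in>{n. 1 \<le> n \<and> m \<in> cuffs n}. piece_map n ` \<kappa> n ` half_open_square) = \<psi> ` V"
  proof (intro equalityI subsetI)
    fix p assume "p \<in> (\<Union>n\<in>{n. 1 \<le> n \<and> m \<in> cuffs n}. piece_map n ` \<kappa> n ` half_open_square)"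
    then obtain n w where w: "n \<in> {m, k}" "w \<in> half_open_square" "p = piece_map n (\<kappa> n w)"
      unfolding cuffs by blast
    \<comment> \<open>On the middle line \<open>\<psi>\<close> is defined through piece
      \<open>m\<close>. A bottom point of the other collar needs \<open>middle\<close> and
      \<open>mid\<close>, which identify both descriptions in the earring.\<close>
    have "\<psi> (if n = m then w else cnj w) = p"
    proof (cases "n = m \<or> Im w \<noteq> 0")
      case True
      then show ?thesis
        using w by (auto simp: \<psi>_def half_open_square_def)
    next
      case False
      then have "cnj w = w"
        by (simp add: complex_eq_iff)
      then show ?thesis
        using False w middle[of n w] mid[of w] half_open_square_subset
        by (auto simp: half_open_square_def K)
    qed
    moreover have "(if n = m then w else cnj w) \<in> V"
      using w by (auto simp: V half_open_square_def)
    ultimately show "p \<in> \<psi> ` V"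
      by blast
  next
    fix p assume "p \<in> \<psi> ` V"
    then obtain w where w: "w \<in> V" "p = \<psi> w"
      by blast
    show "p \<in> (\<Union>n\<in>{n. 1 \<le> n \<and> m \<in> cuffs n}. piece_map n ` \<kappa> n ` half_open_square)"
    proof (cases "0 \<le> Im w")
      case True
      then show ?thesis
        unfolding cuffs using w by (auto simp: \<psi>_def V half_open_square_def)
    next
      case False
      then have "cnj w \<in> half_open_square" "p = piece_map k (\<kappa> k (cnj w))"
        using w by (auto simp: \<psi>_def V half_open_square_def)
      then show ?thesis
        unfolding cuffs by blast
    qed
  qed
  note nbhd = collar_neighbourhood[OF m coll, unfolded image]
  have halves: "subtopology (top_of_set K) {w \<in> topspace (top_of_set K). 0 \<le> Im w} = top_of_set unit_square"
    "subtopology (top_of_set K) {w \<in> topspace (top_of_set K). Im w \<le> 0} = top_of_set (cnj ` unit_square)"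
  proof -
    have "K \<inter> {w \<in> topspace (top_of_set K). 0 \<le> Im w} = unit_square"
      by (auto simp: K unit_square_def)
    moreover have "w \<in> cnj ` unit_square" if "w \<in> K" "Im w \<le> 0" for w
      using that by (intro image_eqI[of _ _ "cnj w"]) (auto simp: K unit_square_def)
    then have "K \<inter> {w \<in> topspace (top_of_set K). Im w \<le> 0} = cnj ` unit_square"
      by (auto simp: K unit_square_def)
    ultimately show "subtopology (top_of_set K) {w \<in> topspace (top_of_set K). 0 \<le> Im w} = top_of_set unit_square"
      "subtopology (top_of_set K) {w \<in> topspace (top_of_set K). Im w \<le> 0} = top_of_set (cnj ` unit_square)"
      by (simp_all add: subtopology_subtopology)
  qed
  have "continuous_map (top_of_set unit_square) pants (piece_map n \<circ> \<kappa> n)" if "n \<in> {m, k}" for n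
    using that m k continuous_map_piece_map[of n] \<kappa>[OF that]
    by (intro continuous_map_compose[of _ "top_of_set (pants_piece n)"]) (auto simp: collar_def)
  moreover have "continuous_map (top_of_set (cnj ` unit_square)) (top_of_set unit_square) cnj"
    by (auto intro!: continuous_intros)
  ultimately have cont: "continuous_map (top_of_set unit_square) pants (piece_map m \<circ> \<kappa> m)"
      "continuous_map (top_of_set (cnj ` unit_square)) pants ((piece_map k \<circ> \<kappa> k) \<circ> cnj)"
    using continuous_map_compose by blast+
  have "continuous_map (top_of_set K) pants
      (\<lambda>w. if 0 \<le> Im w then (piece_map m \<circ> \<kappa> m) w else ((piece_map k \<circ> \<kappa> k) \<circ> cnj) w)"
  proof (rule continuous_map_cases_le)
    show "continuous_map (top_of_set K) euclideanreal Im"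
      by (auto intro!: continuous_intros)
    show "continuous_map (subtopology (top_of_set K) {w \<in> topspace (top_of_set K). 0 \<le> Im w}) pants (piece_map m \<circ> \<kappa> m)"
      unfolding halves by (rule cont)
    show "continuous_map (subtopology (top_of_set K) {w \<in> topspace (top_of_set K). Im w \<le> 0}) pants (piece_map k \<circ> \<kappa> k \<circ> cnj)"
      unfolding halves by (rule cont)
    fix w assume w: "w \<in> topspace (top_of_set K)" "0 = Im w"
    then have "w \<in> unit_square" "cnj w = w"
      by (auto simp: K unit_square_def complex_eq_iff)
    then show "(piece_map m \<circ> \<kappa> m) w = (piece_map k \<circ> \<kappa> k \<circ> cnj) w"
      using w(2) middle[of m w] middle[of k w] by simp
  qed auto
  then have cont: "continuous_map (top_of_set K) pants \<psi>"
    by (rule continuous_map_eq) (simp add: \<psi>_def)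
  have "compact K"
    by (simp add: K_def)
  then have homeo: "homeomorphic_map (top_of_set V) (subtopology pants (\<psi> ` V)) \<psi>"
  proof (rule homeomorphic_map_compact_restriction[OF Hausdorff_pants _ cont])
    show VK: "V \<subseteq> K"
      by (auto simp: K V)
    fix w w' assume w: "w \<in> V" "w' \<in> K" "\<psi> w = \<psi> w'"
    then have wK: "w \<in> K"
      using VK by blast
    have sq: "w \<in> half_open_square" if "0 < Im w"
      using w that by (auto simp: V half_open_square_def)
    have sq': "cnj w \<in> half_open_square" if "Im w < 0"
      using w that by (auto simp: V half_open_square_def)
    note neq = piece_map_neq_earring_map[OF m _ loop] piece_map_neq_earring_map[OF k(1) _ loop]
    \<comment> \<open>The sign of the imaginary part decides whether the image lies in the interior
      of piece \<open>m\<close>, in the interior of piece \<open>k\<close>, or in the earring. These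
      sets are disjoint since \<open>k\<close> differs from \<open>m\<close>.\<close>
    consider "0 < Im w" "0 < Im w'" | "Im w < 0" "Im w' < 0" | "Im w = 0" "Im w' = 0"
      | "0 < Im w" "Im w' < 0" | "Im w < 0" "0 < Im w'" | "Im w = 0 \<longleftrightarrow> Im w' \<noteq> 0"
      by linarith
    then show "w = w'"
    proof cases
      case 1
      then have "\<kappa> m w = \<kappa> m w'"
        using up[OF wK] up[OF w(2)] w(3) piece_map_eq_iff[OF m _ m] by metis
      moreover have "w' \<in> unit_square"
        using w(2) 1 by (auto simp: K unit_square_def)
      ultimately show ?thesis
        using \<kappa>[of m] sq 1 by (auto simp: collar_def)
    next
      case 2
      then have "\<kappa> k (cnj w) = \<kappa> k (cnj w')"
        using down[OF wK] down[OF w(2)] w(3) piece_map_eq_iff[OF k(1) _ k(1)] by metis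
      moreover have "cnj w' \<in> unit_square"
        using w(2) 2 by (auto simp: K unit_square_def)
      ultimately have "cnj w = cnj w'"
        using \<kappa>[of k] sq'[OF 2(1)] unfolding collar_def by blast
      then show ?thesis
        by simp
    next
      case 3
      then have "earring_loop m (Re w) = earring_loop m (Re w')"
        using mid[OF wK] mid[OF w(2)] w(3) loop[OF wK] loop[OF w(2)] by (metis earring_map_eq_iff)
      then have "Re w = Re w'"
        using w m by (intro earring_loop_inject[of m]) (auto simp: V K)
      then show ?thesis
        using 3 by (simp add: complex_eq_iff)
    next
      case 4
      then show ?thesis
        using up[OF wK] down[OF w(2)] w(3) piece_map_eq_iff[OF m _ k(1)] k(2) by metis
    next
      case 5
      then show ?thesis
        using down[OF wK] up[OF w(2)] w(3) piece_map_eq_iff[OF m _ k(1)] k(2) by metis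
    next
      case 6
      have "\<psi> u \<noteq> \<psi> v" if "u \<in> K" "v \<in> K" "Im u = 0" "Im v \<noteq> 0" for u v
        using that mid[of u] up[of v] down[of v] neq[OF _ that(1)] by (metis linorder_neqE_linordered_idom)
      then show ?thesis
        using 6 w wK by metis
    qed
  qed
  show thesis
    using that[OF _ _ nbhd(1) homeo nbhd(2)] by (simp add: V_def open_box bounded_box)
qed

section \<open>The punctured Hawaiian pants\<close>

abbreviation punctured_pants :: "(complex + nat \<times> complex) set topology" where
  "punctured_pants \<equiv> subtopology pants (topspace pants - {earring_map 0})"

lemma punctured_pants_open:
  assumes "openin pants U" "earring_map 0 \<notin> U"
  shows "openin punctured_pants U" "subtopology punctured_pants U = subtopology pants U"
proof -
  have U: "U \<subseteq> topspace pants - {earring_map 0}"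
    using assms openin_subset by blast
  then show "openin punctured_pants U"
    using assms(1) by (metis inf.absorb2 openin_subtopology_Int2)
  show "subtopology punctured_pants U = subtopology pants U"
    using U by (simp add: subtopology_subtopology Int_absorb1)
qed

lemma punctured_pants_boundary_chart:
  obtains V \<psi> where "openin (top_of_set half_plane) V" "openin punctured_pants (\<psi> ` V)"
    "homeomorphic_map (top_of_set V) (subtopology punctured_pants (\<psi> ` V)) \<psi>"
    "\<And>y. y \<in> earring_circle 1 - {0} \<Longrightarrow> \<exists>w\<in>V. Im w = 0 \<and> earring_map y = \<psi> w"
proof (rule boundary_cuff_chart)
  fix V \<psi>
  assume V: "openin (top_of_set half_plane) V" "openin pants (\<psi> ` V)"
    "homeomorphic_map (top_of_set V) (subtopology pants (\<psi> ` V)) \<psi>"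
    "{y \<in> hawaiian_earring. earring_map y \<in> \<psi> ` V} = earring_circle 1 - {0}"
    "\<And>y. y \<in> earring_circle 1 - {0} \<Longrightarrow> \<exists>w\<in>V. Im w = 0 \<and> earring_map y = \<psi> w"
  have "earring_map 0 \<notin> \<psi> ` V"
    using V(4) zero_in_earring by blast
  note P = punctured_pants_open[OF V(2) this]
  show thesis
    using that[OF V(1) P(1) _ V(5)] V(3) unfolding P(2) by blast
qed

lemma punctured_pants_cuff_chart:
  assumes "2 \<le> m"
  obtains V :: "complex set" and \<psi> where "open V" "bounded V" "openin punctured_pants (\<psi> ` V)"
    "homeomorphic_map (top_of_set V) (subtopology punctured_pants (\<psi> ` V)) \<psi>"
    "earring_map ` (earring_circle m - {0}) \<subseteq> \<psi> ` V"
proof (rule interior_cuff_chart[OF assms])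
  fix V :: "complex set" and \<psi>
  assume V: "open V" "bounded V" "openin pants (\<psi> ` V)"
    "homeomorphic_map (top_of_set V) (subtopology pants (\<psi> ` V)) \<psi>"
    "{y \<in> hawaiian_earring. earring_map y \<in> \<psi> ` V} = earring_circle m - {0}"
  have "earring_map 0 \<notin> \<psi> ` V"
    using V(5) zero_in_earring by blast
  note P = punctured_pants_open[OF V(3) this]
  show thesis
    using that[OF V(1,2) P(1)] V(4,5) unfolding P(2) by blast
qed

lemma punctured_pants_piece_chart:
  assumes "1 \<le> n"
  defines "V \<equiv> pants_piece n - piece_boundary n"
  shows "open V" "bounded V" "openin punctured_pants (piece_map n ` V)"
    "homeomorphic_map (top_of_set V) (subtopology punctured_pants (piece_map n ` V)) (piece_map n)"
proof -
  have "earring_map 0 \<notin> piece_map n ` V"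
    using piece_map_neq_earring_map[OF assms(1) _ zero_in_earring] by (auto simp: V_def)
  note P = punctured_pants_open[OF openin_piece_interior[OF assms(1), folded V_def] this]
  show "openin punctured_pants (piece_map n ` V)"
    by (rule P(1))
  show "homeomorphic_map (top_of_set V) (subtopology punctured_pants (piece_map n ` V)) (piece_map n)"
    unfolding P(2) using piece_interior_chart[OF assms(1)] by (simp only: V_def)
  show "open V" "bounded V"
    unfolding V_def using open_piece_minus_boundary[OF assms(1)] compact_imp_bounded[OF compact_piece[OF assms(1)]]
    by (auto intro: bounded_subset)
qed

lemma punctured_pants_cases:
  assumes "p \<in> topspace punctured_pants"
  obtains (boundary) y where "y \<in> earring_circle 1 - {0}" "p = earring_map y"
    | (cuff) m where "2 \<le> m" "p \<in> earring_map ` (earring_circle m - {0})"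
    | (piece) n where "1 \<le> n" "p \<in> piece_map n ` (pants_piece n - piece_boundary n)"
proof -
  have p: "p \<in> topspace pants" "p \<noteq> earring_map 0"
    using assms by auto
  from p(1) show thesis
  proof (cases rule: topspace_pants_cases)
    case (earring y)
    then obtain m where m: "1 \<le> m" "y \<in> earring_circle m - {0}"
      using p(2) by (auto simp: hawaiian_earring_def)
    show thesis
    proof (cases "m = 1")
      case True
      then show thesis
        using boundary m earring by blast
    next
      case False
      then show thesis
        using cuff[of m] m earring by auto
    qed
  qed (use piece in blast)
qed

text \<open>Serves twice: these parametrisations supply the charts off the first circle, and they
  exclude boundary points there.\<close>

lemma punctured_pants_planar_chart:
  assumes "p \<in> topspace punctured_pants" "p \<notin> earring_map ` (earring_circle 1 - {0})"
  obtains V :: "complex set" and \<psi> where "open V" "bounded V" "openin punctured_pants (\<psi> ` V)"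
    "homeomorphic_map (top_of_set V) (subtopology punctured_pants (\<psi> ` V)) \<psi>" "p \<in> \<psi> ` V"
  using assms(1)
proof (cases rule: punctured_pants_cases)
  case (boundary y)
  then show thesis
    using assms(2) by blast
next
  case (cuff m)
  show thesis
  proof (rule punctured_pants_cuff_chart[OF cuff(1)])
    fix V :: "complex set" and \<psi>
    assume "open V" "bounded V" "openin punctured_pants (\<psi> ` V)"
      "homeomorphic_map (top_of_set V) (subtopology punctured_pants (\<psi> ` V)) \<psi>"
      "earring_map ` (earring_circle m - {0}) \<subseteq> \<psi> ` V"
    then show thesis
      using that[of V \<psi>] cuff(2) by blast
  qed
next
  case (piece n)
  show thesis
    by (rule that[OF punctured_pants_piece_chart[OF piece(1)] piece(2)])
qed

text \<open>Hides whether the parameter domain is open in the plane or in the half-plane, so that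
  one chart can be chosen uniformly for each circle in the countable cover.\<close>

lemma punctured_pants_circle_chart:
  assumes "1 \<le> m"
  obtains V :: "complex set" and \<psi> where "openin punctured_pants (\<psi> ` V)"
    "homeomorphic_map (top_of_set V) (subtopology punctured_pants (\<psi> ` V)) \<psi>"
    "earring_map ` (earring_circle m - {0}) \<subseteq> \<psi> ` V"
proof (cases "m = 1")
  case True
  show thesis
    by (rule punctured_pants_boundary_chart, rule that) (use True in blast)+
next
  case False
  then have "2 \<le> m"
    using assms by simp
  then show thesis
    by (rule punctured_pants_cuff_chart) (rule that)
qed

lemma second_countable_punctured_pants: "second_countable punctured_pants"
proof -
  have "\<forall>m\<in>{1..}. \<exists>U. openin punctured_pants U \<and> second_countable (subtopology punctured_pants U) \<and>
      earring_map ` (earring_circle m - {0}) \<subseteq> U"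
    using punctured_pants_circle_chart second_countable_chart_domain by (metis atLeast_iff)
  then obtain U where U: "\<And>m. 1 \<le> m \<Longrightarrow> openin punctured_pants (U m)"
      "\<And>m. 1 \<le> m \<Longrightarrow> second_countable (subtopology punctured_pants (U m))"
      "\<And>m. 1 \<le> m \<Longrightarrow> earring_map ` (earring_circle m - {0}) \<subseteq> U m"
    by (metis atLeast_iff)
  define W where "W n = piece_map n ` (pants_piece n - piece_boundary n)" for n
  have W: "openin punctured_pants (W n)" "second_countable (subtopology punctured_pants (W n))"
    if "1 \<le> n" for n
    unfolding W_def using punctured_pants_piece_chart[OF that] second_countable_chart_domain by blast+
  show ?thesis
  proof (rule second_countable_open_cover[where I = "U ` {1..} \<union> W ` {1..}" and U = "\<lambda>S. S"])
    show "topspace punctured_pants \<subseteq> (\<Union>S\<in>U ` {1..} \<union> W ` {1..}. S)"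
    proof
      fix p assume "p \<in> topspace punctured_pants"
      then show "p \<in> (\<Union>S\<in>U ` {1..} \<union> W ` {1..}. S)"
      proof (cases rule: punctured_pants_cases)
        case (boundary y)
        then have "p \<in> U 1"
          using U(3)[of 1] by auto
        then show ?thesis
          by auto
      next
        case (cuff m)
        then have "p \<in> U m" "m \<in> {1..}"
          using U(3)[of m] by auto
        then show ?thesis
          by blast
      next
        case (piece n)
        then have "p \<in> W n" "n \<in> {1..}"
          by (auto simp: W_def)
        then show ?thesis
          by blast
      qed
    qed
  qed (use U W in auto)
qed

lemma two_manifold_punctured_pants: "two_manifold_with_boundary punctured_pants"
  unfolding two_manifold_with_boundary_def
proof (intro conjI ballI)
  show "Hausdorff_space punctured_pants"
    by (rule Hausdorff_space_subtopology[OF Hausdorff_pants])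
  show "second_countable punctured_pants"
    by (rule second_countable_punctured_pants)
  fix p assume p: "p \<in> topspace punctured_pants"
  show "\<exists>U \<phi>. p \<in> U \<and> half_plane_chart punctured_pants U \<phi>"
  proof (cases "p \<in> earring_map ` (earring_circle 1 - {0})")
    case True
    obtain V \<psi> where V: "openin (top_of_set half_plane) V" "openin punctured_pants (\<psi> ` V)"
      "homeomorphic_map (top_of_set V) (subtopology punctured_pants (\<psi> ` V)) \<psi>"
      "\<And>y. y \<in> earring_circle 1 - {0} \<Longrightarrow> \<exists>w\<in>V. Im w = 0 \<and> earring_map y = \<psi> w"
      by (rule punctured_pants_boundary_chart) (rule that)
    obtain \<phi> where "half_plane_chart punctured_pants (\<psi> ` V) \<phi>"
      using half_plane_chart_inverse[OF V(2,1,3)] by blast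
    moreover have "p \<in> \<psi> ` V"
      using True V(4) by blast
    ultimately show ?thesis
      by blast
  next
    case False
    then show ?thesis
      using punctured_pants_planar_chart[OF p False] half_plane_chart_planar by metis
  qed
qed

text \<open>The boundary is defined by the existence of a chart. One explicit chart therefore
  suffices on the first circle, whereas elsewhere a planar parametrisation has to rule out every
  chart.\<close>

lemma two_manifold_boundary_punctured_pants:
  "two_manifold_boundary punctured_pants = earring_map ` (earring_circle 1 - {0})"
proof (intro equalityI subsetI)
  fix p assume "p \<in> two_manifold_boundary punctured_pants"
  then obtain U \<phi> where p: "p \<in> topspace punctured_pants" "p \<in> U"
      "half_plane_chart punctured_pants U \<phi>" "Im (\<phi> p) = 0"
    by (auto simp: two_manifold_boundary_def)
  show "p \<in> earring_map ` (earring_circle 1 - {0})"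
  proof (rule ccontr)
    assume "p \<notin> earring_map ` (earring_circle 1 - {0})"
    then obtain V :: "complex set" and \<psi> where V: "open V"
        "homeomorphic_map (top_of_set V) (subtopology punctured_pants (\<psi> ` V)) \<psi>" "p \<in> \<psi> ` V"
      using punctured_pants_planar_chart[OF p(1)] by metis
    then obtain w where w: "w \<in> V" "p = \<psi> w"
      by blast
    have "continuous_map (top_of_set V) punctured_pants \<psi>"
      using homeomorphic_imp_continuous_map[OF V(2)] continuous_map_in_subtopology by blast
    moreover have "inj_on \<psi> V"
      using homeomorphic_imp_injective_map[OF V(2)] by simp
    ultimately show False
      using half_plane_chart_planar_point[OF V(1) _ _ p(3) w(1)] p(2,4) w(2) by blast
  qed
next
  fix p assume "p \<in> earring_map ` (earring_circle 1 - {0})"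
  then obtain y where y: "y \<in> earring_circle 1 - {0}" "p = earring_map y"
    by blast
  obtain V \<psi> where V: "openin (top_of_set half_plane) V" "openin punctured_pants (\<psi> ` V)"
    "homeomorphic_map (top_of_set V) (subtopology punctured_pants (\<psi> ` V)) \<psi>"
    "\<And>y. y \<in> earring_circle 1 - {0} \<Longrightarrow> \<exists>w\<in>V. Im w = 0 \<and> earring_map y = \<psi> w"
    by (rule punctured_pants_boundary_chart) (rule that)
  obtain w where w: "w \<in> V" "Im w = 0" "p = \<psi> w"
    using V(4)[OF y(1)] y(2) by blast
  obtain \<phi> where "half_plane_chart punctured_pants (\<psi> ` V) \<phi>" "\<And>w. w \<in> V \<Longrightarrow> \<phi> (\<psi> w) = w"
    using half_plane_chart_inverse[OF V(2,1,3)] by blast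
  moreover have "p \<in> topspace punctured_pants"
    using openin_subset[OF V(2)] w by blast
  ultimately show "p \<in> two_manifold_boundary punctured_pants"
    unfolding two_manifold_boundary_def using w by (intro CollectI conjI exI[of _ "\<psi> ` V"] exI[of _ \<phi>]) auto
qed

end

theorem proposition2p1:
  fixes D E F :: "nat \<Rightarrow> complex set"
    and \<alpha> \<beta> \<gamma> :: "nat \<Rightarrow> real \<Rightarrow> complex"
    and f :: "nat \<Rightarrow> complex \<Rightarrow> complex"
  assumes "hawaiian_pants_data D E F \<alpha> \<beta> \<gamma> f"
  defines "P \<equiv> hawaiian_pants D E F f"
    and "\<iota> \<equiv> earring_inclusion D E F f"
  shows "(two_manifold_with_boundary (subtopology P (topspace P - {\<iota> 0})) \<and>
          two_manifold_boundary (subtopology P (topspace P - {\<iota> 0})) =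
            \<iota> ` (earring_circle 1 - {0})) \<and>
         (connected_space P \<and> locally_path_connected_space P)"
proof -
  interpret hawaiian_pants_data D E F \<alpha> \<beta> \<gamma> f
    by (rule assms(1))
  show ?thesis
    unfolding P_def \<iota>_def
    using two_manifold_punctured_pants two_manifold_boundary_punctured_pants
      connected_pants locally_path_connected_pants by blast
qed

end
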